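(* Let $\mathbb{D}\subset\mathbb{R}^2$ be the open unit disk. Then for all $\lambda\in[3,14]$ \[ \mathcal{N}^{\mathrm N}_{\mathbb{D}}(\lambda)\ge\frac{\lambda^2}{4}. \]
   Context: For a bounded domain $\Omega\subset\mathbb{R}^d$ with Lipschitz boundary, let $0=\mu_1(\Omega)\le\mu_2(\Omega)\le\dots$ be the eigenvalues, enumerated with multiplicity, of the Neumann Laplacian: $-\Delta u=\mu u$ in $\Omega$, $\partial_n u=0$ on $\partial\Omega$. The counting function is $\mathcal{N}^{\mathrm N}_\Omega(\lambda):=\#\{n:\mu_n(\Omega)\le\lambda^2\}$. *)

theory Defs
  imports "HOL-Analysis.Analysis"
begin

subsection \<open>The Sobolev space \<open>H\<^sup>1\<close>\<close>

definition square_integrable_on :: "('a::euclidean_space \<Rightarrow> 'b::euclidean_space) \<Rightarrow> 'a set \<Rightarrow> bool"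
    (infix \<open>square'_integrable'_on\<close> 46) where
  "f square_integrable_on \<Omega> \<longleftrightarrow>
     f \<in> borel_measurable (lebesgue_on \<Omega>) \<and> integrable (lebesgue_on \<Omega>) (\<lambda>x. (norm (f x))\<^sup>2)"

text \<open>\<open>\<phi>\<close> is a continuously differentiable function with gradient \<open>\<psi>\<close>, compactly supported
  in \<open>\<Omega>\<close>. As in Evans and Gariepy, \<open>C\<^sup>1\<close> test functions are used; by mollification
  they define the same weak gradients as smooth ones.\<close>

definition test_function :: "'a::euclidean_space set \<Rightarrow> ('a \<Rightarrow> real) \<Rightarrow> ('a \<Rightarrow> 'a) \<Rightarrow> bool" where
  "test_function \<Omega> \<phi> \<psi> \<longleftrightarrow>
     (\<forall>x. GDERIV \<phi> x :> \<psi> x) \<and> continuous_on UNIV \<psi> \<and>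
     compact (closure {x. \<phi> x \<noteq> 0}) \<and> closure {x. \<phi> x \<noteq> 0} \<subseteq> \<Omega>"

definition weak_gradient :: "'a::euclidean_space set \<Rightarrow> ('a \<Rightarrow> real) \<Rightarrow> ('a \<Rightarrow> 'a) \<Rightarrow> bool" where
  "weak_gradient \<Omega> u g \<longleftrightarrow>
     (\<forall>\<phi> \<psi>. test_function \<Omega> \<phi> \<psi> \<longrightarrow>
        (LINT x|lebesgue_on \<Omega>. u x *\<^sub>R \<psi> x) = - (LINT x|lebesgue_on \<Omega>. \<phi> x *\<^sub>R g x))"

text \<open>\<open>u\<close> represents an element of \<open>H\<^sup>1(\<Omega>)\<close>, and its weak gradient is represented by \<open>g\<close>.\<close>

definition H1_with_gradient :: "'a::euclidean_space set \<Rightarrow> ('a \<Rightarrow> real) \<Rightarrow> ('a \<Rightarrow> 'a) \<Rightarrow> bool" where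
  "H1_with_gradient \<Omega> u g \<longleftrightarrow>
     u square_integrable_on \<Omega> \<and> g square_integrable_on \<Omega> \<and> weak_gradient \<Omega> u g"

subsection \<open>Neumann eigenvalues\<close>

text \<open>The weak form of \<open>-\<Delta>u = t u\<close> in \<open>\<Omega>\<close>, \<open>\<partial>\<^sub>n u = 0\<close> on the boundary, which is what these
  equations mean when \<open>\<Omega>\<close> is only a Lipschitz domain. The boundary condition is the
  natural one: it is encoded by testing against all of \<open>H\<^sup>1(\<Omega>)\<close>.\<close>

definition neumann_eigenspace :: "'a::euclidean_space set \<Rightarrow> real \<Rightarrow> ('a \<Rightarrow> real) set" where
  "neumann_eigenspace \<Omega> t =
     {u. \<exists>g. H1_with_gradient \<Omega> u g \<and>
         (\<forall>v h. H1_with_gradient \<Omega> v h \<longrightarrow>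
            (LINT x|lebesgue_on \<Omega>. g x \<bullet> h x) = t * (LINT x|lebesgue_on \<Omega>. u x * v x))}"

text \<open>Elements of the eigenspace are functions, not classes modulo null sets, so linear
  independence is taken almost everywhere and the multiplicity is the dimension of the
  eigenspace modulo null sets. It is nonzero precisely for the eigenvalues.\<close>

definition ae_independent :: "'a::euclidean_space set \<Rightarrow> nat \<Rightarrow> (nat \<Rightarrow> 'a \<Rightarrow> real) \<Rightarrow> bool" where
  "ae_independent \<Omega> n u \<longleftrightarrow>
     (\<forall>c :: nat \<Rightarrow> real. (AE x in lebesgue_on \<Omega>. (\<Sum>i<n. c i * u i x) = 0) \<longrightarrow> (\<forall>i<n. c i = 0))"

definition neumann_multiplicity :: "'a::euclidean_space set \<Rightarrow> real \<Rightarrow> enat" where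
  "neumann_multiplicity \<Omega> t =
     Sup {enat n | n. \<exists>u. (\<forall>i<n. u i \<in> neumann_eigenspace \<Omega> t) \<and> ae_independent \<Omega> n u}"

definition ecard :: "'a set \<Rightarrow> enat" where
  "ecard A = (if finite A then enat (card A) else \<infinity>)"

text \<open>The eigenvalues up to \<open>t\<close>, each eigenvalue \<open>s\<close> occurring as often as its multiplicity,
  as pairs \<open>(s, k)\<close>.\<close>

definition neumann_spectrum_upto :: "'a::euclidean_space set \<Rightarrow> real \<Rightarrow> (real \<times> nat) set" where
  "neumann_spectrum_upto \<Omega> t = {(s, k). s \<le> t \<and> enat k < neumann_multiplicity \<Omega> s}"

text \<open>The \<open>n\<close>-th eigenvalue (\<open>n \<ge> 1\<close>), in increasing order and with multiplicity: the least \<open>t\<close>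
  such that at least \<open>n\<close> eigenvalues are at most \<open>t\<close> (and \<open>\<infinity>\<close> if there is no such \<open>t\<close>). That
  this agrees with any enumeration of the eigenvalues is shown below.\<close>

definition neumann_eigenvalue :: "'a::euclidean_space set \<Rightarrow> nat \<Rightarrow> ereal" where
  "neumann_eigenvalue \<Omega> n = Inf {ereal t | t. enat n \<le> ecard (neumann_spectrum_upto \<Omega> t)}"

definition neumann_counting :: "'a::euclidean_space set \<Rightarrow> real \<Rightarrow> enat" where
  "neumann_counting \<Omega> lam = ecard {n. 1 \<le> n \<and> neumann_eigenvalue \<Omega> n \<le> ereal (lam\<^sup>2)}"

lemma neumann_eigenvalue_eqI:
  fixes \<Omega> :: "'a::euclidean_space set" and \<mu> :: "nat \<Rightarrow> real"
  assumes mono: "\<And>m n. 1 \<le> m \<Longrightarrow> m \<le> n \<Longrightarrow> \<mu> m \<le> \<mu> n"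
    and fin: "\<And>t. finite {n. 1 \<le> n \<and> \<mu> n \<le> t}"
    and mult: "\<And>t. ecard {n. 1 \<le> n \<and> \<mu> n = t} = neumann_multiplicity \<Omega> t"
    and n: "1 \<le> n"
  shows "neumann_eigenvalue \<Omega> n = ereal (\<mu> n)"
proof -
  have card_eq: "ecard (neumann_spectrum_upto \<Omega> t) = enat (card {m. 1 \<le> m \<and> \<mu> m \<le> t})" for t
  proof -
    define F where "F s = {m. 1 \<le> m \<and> \<mu> m = s}" for s
    define I where "I = {m. 1 \<le> m \<and> \<mu> m \<le> t}"
    have finI: "finite I" unfolding I_def by (rule fin)
    have finF: "finite (F s)" for s
      unfolding F_def by (rule finite_subset[OF _ fin[of s]]) auto
    have m: "neumann_multiplicity \<Omega> s = enat (card (F s))" for s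
      using mult[of s] finF[of s] by (simp add: F_def ecard_def)
    have ne: "s \<in> \<mu> ` I" if "s \<le> t" "k < card (F s)" for s k
    proof -
      have "F s \<noteq> {}" using that(2) by auto
      then show ?thesis using that(1) by (auto simp: F_def I_def)
    qed
    have P: "neumann_spectrum_upto \<Omega> t = (SIGMA s:\<mu> ` I. {..<card (F s)})"
      using ne by (auto simp: neumann_spectrum_upto_def m I_def)
    have I: "I = (\<Union>s\<in>\<mu> ` I. F s)"
      by (auto simp: I_def F_def)
    have "card I = (\<Sum>s\<in>\<mu> ` I. card (F s))"
      by (subst I, rule card_UN_disjoint) (use finI finF in \<open>auto simp: F_def\<close>)
    then have "ecard (neumann_spectrum_upto \<Omega> t) = enat (card I)"
      unfolding P ecard_def using finI by simp
    then show ?thesis by (simp add: I_def)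
  qed
  have "enat n \<le> ecard (neumann_spectrum_upto \<Omega> t) \<longleftrightarrow> \<mu> n \<le> t" for t
  proof
    assume "\<mu> n \<le> t"
    then have "{1..n} \<subseteq> {m. 1 \<le> m \<and> \<mu> m \<le> t}"
      using mono[of _ n] by (auto intro: order_trans[of _ "\<mu> n"])
    from card_mono[OF fin this] show "enat n \<le> ecard (neumann_spectrum_upto \<Omega> t)"
      by (simp add: card_eq)
  next
    assume *: "enat n \<le> ecard (neumann_spectrum_upto \<Omega> t)"
    show "\<mu> n \<le> t"
    proof (rule ccontr)
      assume "\<not> \<mu> n \<le> t"
      then have "{m. 1 \<le> m \<and> \<mu> m \<le> t} \<subseteq> {1..<n}"
        using mono[OF n] by (fastforce simp: not_le)
      from card_mono[OF _ this] * n show False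
        by (simp add: card_eq)
    qed
  qed
  then show ?thesis
    unfolding neumann_eigenvalue_def by (auto intro!: Inf_eqI)
qed

end

theory Submission
  imports Defs
begin

text \<open>A lower bound for the counting function only needs sufficiently many eigenfunctions. On the
  disk these are \<open>u(x) = Re (c z\<^sup>m) F\<^sub>m(s |x|\<^sup>2)\<close>, where \<open>z = x\<^sub>1 + i x\<^sub>2\<close> and
  \<open>F\<^sub>m(s) = \<Sum>\<^sub>n (-s)\<^sup>n / (n! (n + m)!)\<close> is a rescaled Bessel function; the eigenvalue is \<open>4 s\<close>
  when \<open>s\<close> is a zero of \<open>m F\<^sub>m(s) - 2 s F\<^sub>m\<^sub>+\<^sub>1(s)\<close>. For \<open>v\<close> in \<open>H\<^sup>1\<close> of the disk the weak
  equation follows by testing the definition of the weak gradient of \<open>v\<close> with \<open>\<eta> \<partial>\<^sub>i u\<close> for radial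
  cutoffs \<open>\<eta>\<close>: although \<open>\<nabla>\<eta>\<close> blows up near the circle, \<open>\<nabla>\<eta> \<bullet> \<nabla>u\<close> stays bounded, because \<open>\<partial>\<^sub>r u\<close>
  vanishes there to first order, and so no trace theorem is needed.

  With \<open>\<lambda>\<^sup>2 / 4 \<in> (j, j + 1]\<close>, it remains to find \<open>j + 1\<close> eigenvalues \<open>4 s\<close> with \<open>s \<le> j\<close>, for
  \<open>j = 2, \<dots>, 48\<close>. The zeros \<open>s\<close> are located by the signs of the power series at integers.\<close>

subsection \<open>Integration by parts\<close>

lemma lborel_translate:
  fixes f :: "'a::euclidean_space \<Rightarrow> real"
  assumes "f \<in> borel_measurable borel"
  shows "integral\<^sup>L lborel (\<lambda>x. f (c + x)) = integral\<^sup>L lborel f"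
    and "integrable lborel (\<lambda>x. f (c + x)) \<longleftrightarrow> integrable lborel f"
proof -
  have "integral\<^sup>L (distr lborel borel ((+) c)) f = integral\<^sup>L lborel (\<lambda>x. f (c + x))"
    by (rule integral_distr) (use assms in auto)
  then show "integral\<^sup>L lborel (\<lambda>x. f (c + x)) = integral\<^sup>L lborel f"
    by (simp add: lborel_distr_plus)
  have "integrable (distr lborel borel ((+) c)) f \<longleftrightarrow> integrable lborel (\<lambda>x. f (c + x))"
    by (rule integrable_distr_eq) (use assms in auto)
  then show "integrable lborel (\<lambda>x. f (c + x)) \<longleftrightarrow> integrable lborel f"
    by (simp add: lborel_distr_plus)
qed

lemma GDERIV_continuous_on:
  assumes "\<And>x. GDERIV f x :> g x"
  shows "continuous_on S f"
proof (rule continuous_at_imp_continuous_on, rule ballI)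
  show "isCont f x" for x
    using has_derivative_continuous[OF assms[unfolded gderiv_def]] .
qed

lemma gradient_eq_0_outside_support:
  fixes f :: "'a::real_inner \<Rightarrow> real"
  assumes f: "GDERIV f x :> D" and x: "x \<notin> closure {y. f y \<noteq> 0}"
  shows "D = 0"
proof -
  have "((\<lambda>_. 0) has_derivative (\<lambda>h. h \<bullet> D)) (at x)"
  proof (rule has_derivative_transform_within_open)
    show "(f has_derivative (\<lambda>h. h \<bullet> D)) (at x)" using f by (simp add: gderiv_def)
    show "open (- closure {y. f y \<noteq> 0})" by auto
    show "x \<in> - closure {y. f y \<noteq> 0}" using x by simp
    show "\<And>y. y \<in> - closure {y. f y \<noteq> 0} \<Longrightarrow> f y = 0"
      using closure_subset[of "{y. f y \<noteq> 0}"] by auto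
  qed
  then have "(\<lambda>h. h \<bullet> D) = (\<lambda>_. 0)"
    by (rule has_derivative_unique[OF _ has_derivative_const])
  from fun_cong[OF this, of D] show ?thesis by simp
qed

text \<open>By translation invariance the difference quotients of \<open>f\<close> in a basis
  direction have integral 0, and dominated convergence carries this over to the directional
  derivative.\<close>

lemma integral_gradient_eq_0:
  fixes f :: "'a::euclidean_space \<Rightarrow> real" and g :: "'a \<Rightarrow> 'a"
  assumes f: "\<And>x. GDERIV f x :> g x" and g: "continuous_on UNIV g"
    and K: "compact (closure {x. f x \<noteq> 0})"
  shows "integrable lborel g" and "integral\<^sup>L lborel g = 0"
proof -
  define K where "K = closure {x. f x \<noteq> 0}"
  have cK: "compact K" using K by (simp add: K_def)
  have fK: "f x = 0" if "x \<notin> K" for x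
    using that closure_subset[of "{x. f x \<noteq> 0}"] by (auto simp: K_def)
  have gK: "g x = 0" if "x \<notin> K" for x
    using gradient_eq_0_outside_support[OF f] that by (simp add: K_def)
  have cf: "continuous_on UNIV f" by (rule GDERIV_continuous_on[OF f])
  note [measurable] = borel_measurable_continuous_onI[OF cf] borel_measurable_continuous_onI[OF g]
  have "compact (g ` K)"
    using cK g by (meson compact_continuous_image continuous_on_subset subset_UNIV)
  then obtain B where B: "\<forall>y\<in>g ` K. norm y \<le> B" and B0: "B > 0"
    by (meson bounded_pos compact_imp_bounded)
  have gB: "norm (g x) \<le> B" for x
    using B B0 gK[of x] by (cases "x \<in> K") auto
  have "bounded K" using cK compact_imp_bounded by blast
  have Kb: "emeasure lborel K < \<infinity>"
    using \<open>bounded K\<close> by (rule emeasure_bounded_finite)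
  have Km: "K \<in> sets lborel" by (simp add: K_def)
  show ig: "integrable lborel g"
    by (rule integrableI_bounded_set[OF Km _ Kb, where B=B]) (use gB gK in auto)
  have "compact (f ` K)"
    using cK cf by (meson compact_continuous_image continuous_on_subset subset_UNIV)
  then obtain B' where B': "\<forall>y\<in>f ` K. norm y \<le> B'"
    by (meson bounded_pos compact_imp_bounded)
  have "if": "integrable lborel f"
    by (rule integrableI_bounded_set[OF Km _ Kb, where B=B']) (use B' fK in auto)
  have "integral\<^sup>L lborel g \<bullet> i = 0" if i: "i \<in> Basis" for i
  proof -
    define D where "D n x = real (Suc n) * (f ((1 / real (Suc n)) *\<^sub>R i + x) - f x)" for n x
    have ID: "integral\<^sup>L lborel (D n) = 0" for n
      unfolding D_def using lborel_translate[of f] "if" by simp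
    have line: "((\<lambda>t. f (t *\<^sub>R i + x)) has_real_derivative g (t *\<^sub>R i + x) \<bullet> i) (at t)" for x t
    proof -
      have 1: "((\<lambda>t. t *\<^sub>R i + x) has_derivative (\<lambda>h. h *\<^sub>R i)) (at t)"
        by (auto intro!: derivative_eq_intros)
      have 2: "(f has_derivative (\<lambda>h. h \<bullet> g (t *\<^sub>R i + x))) (at (t *\<^sub>R i + x))"
        using f unfolding gderiv_def .
      show ?thesis
        using diff_chain_at[OF 1 2]
        by (simp add: has_field_derivative_def o_def mult_commute_abs inner_commute[of i])
    qed
    \<comment> \<open>The increments \<open>1 / real (Suc n)\<close> are at most 1, so the closed
      unit neighbourhood of \<open>K\<close> contains the supports of all difference quotients and
      carries a common dominating function.\<close>
    define K' where "K' = {x + y | x y. x \<in> K \<and> y \<in> cball 0 (1::real)}"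
    have cK': "compact K'" unfolding K'_def by (rule compact_sums) (use cK in auto)
    have K'b: "emeasure lborel K' < \<infinity>"
      using cK' by (intro emeasure_bounded_finite compact_imp_bounded)
    have DB: "norm (D n x) \<le> B * indicator K' x" for n x
    proof (cases "x \<in> K'")
      case True
      let ?h = "1 / real (Suc n)"
      have "?h > 0" by simp
      from MVT2[OF this line[of x]] obtain t where
        t: "f (?h *\<^sub>R i + x) - f (0 *\<^sub>R i + x) = (?h - 0) * (g (t *\<^sub>R i + x) \<bullet> i)" by blast
      then have "D n x = g (t *\<^sub>R i + x) \<bullet> i"
        unfolding D_def using t by (simp add: field_simps del: of_nat_Suc)
      also have "norm \<dots> \<le> norm (g (t *\<^sub>R i + x)) * norm i"
        by (simp add: Cauchy_Schwarz_ineq2)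
      also have "\<dots> \<le> B" using gB i by simp
      finally show ?thesis using True by simp
    next
      case False
      have "x \<notin> K" using False unfolding K'_def by (auto dest: spec[of _ x] spec[of _ "0::'a"])
      moreover have "(1 / real (Suc n)) *\<^sub>R i + x \<notin> K"
      proof
        assume "(1 / real (Suc n)) *\<^sub>R i + x \<in> K"
        moreover have "- (1 / real (Suc n)) *\<^sub>R i \<in> cball 0 (1::real)" using i by simp
        moreover have "x = ((1 / real (Suc n)) *\<^sub>R i + x) + (- (1 / real (Suc n)) *\<^sub>R i)" by simp
        ultimately have "x \<in> K'" unfolding K'_def by blast
        then show False using False by simp
      qed
      ultimately show ?thesis using False by (simp add: D_def fK)
    qed
    have "(\<lambda>n. integral\<^sup>L lborel (D n)) \<longlonglongrightarrow> integral\<^sup>L lborel (\<lambda>x. g x \<bullet> i)"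
    proof (rule integral_dominated_convergence[where w = "\<lambda>x. B * indicator K' x"])
      show "(\<lambda>x. g x \<bullet> i) \<in> borel_measurable lborel" by measurable
      show "D n \<in> borel_measurable lborel" for n unfolding D_def by measurable
      have "integrable lborel (indicator K' :: 'a \<Rightarrow> real)"
        using cK' K'b by (intro integrable_real_indicator) (auto intro: borel_compact)
      then show "integrable lborel (\<lambda>x. B * indicator K' x)" by simp
      show "AE x in lborel. (\<lambda>n. D n x) \<longlonglongrightarrow> g x \<bullet> i"
      proof (rule AE_I2)
        fix x
        have "((\<lambda>h. (f (h *\<^sub>R i + x) - f x) / h) \<longlongrightarrow> g x \<bullet> i) (at 0)"
          using line[of x 0] by (simp add: DERIV_def)
        moreover have "filterlim (\<lambda>n. 1 / real (Suc n)) (at 0) sequentially"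
          unfolding filterlim_at using LIMSEQ_Suc[OF lim_1_over_n[where 'a=real]] by simp
        ultimately have "(\<lambda>n. (f ((1 / real (Suc n)) *\<^sub>R i + x) - f x) / (1 / real (Suc n)))
            \<longlonglongrightarrow> g x \<bullet> i" by (rule filterlim_compose)
        then show "(\<lambda>n. D n x) \<longlonglongrightarrow> g x \<bullet> i" by (simp add: D_def mult.commute)
      qed
      show "AE x in lborel. norm (D n x) \<le> B * indicator K' x" for n using DB by simp
    qed
    then have "integral\<^sup>L lborel (\<lambda>x. g x \<bullet> i) = 0"
      unfolding ID by (simp add: LIMSEQ_const_iff)
    then show ?thesis using ig by simp
  qed
  then show "integral\<^sup>L lborel g = 0" 
    by (intro euclidean_eqI[where 'a='a]) (simp only: inner_zero_left)
qed

section \<open>Continuous functions on bounded measurable sets\<close>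

lemma integral_lebesgue_on_eq_lborel:
  fixes g :: "'a::euclidean_space \<Rightarrow> 'b::euclidean_space"
  assumes g: "continuous_on UNIV g" and S: "S \<in> sets lebesgue" and 0: "\<And>x. x \<notin> S \<Longrightarrow> g x = 0"
  shows "integral\<^sup>L (lebesgue_on S) g = integral\<^sup>L lborel g"
proof -
  have "integral\<^sup>L (lebesgue_on S) g = integral\<^sup>L lebesgue (\<lambda>x. indicator S x *\<^sub>R g x)"
    by (rule integral_restrict_space) (use S in simp)
  also have "(\<lambda>x. indicator S x *\<^sub>R g x) = g" using 0 by (auto simp: indicator_def)
  also have "integral\<^sup>L lebesgue g = integral\<^sup>L lborel g"
    by (rule integral_completion) (use borel_measurable_continuous_onI[OF g] in simp)
  finally show ?thesis .
qed

lemma finite_measure_lebesgue_on_bounded: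
  fixes S :: "'a::euclidean_space set"
  assumes "bounded S" "S \<in> sets lebesgue"
  shows "finite_measure (lebesgue_on S)"
proof (rule finite_measureI)
  have "emeasure lebesgue S < \<infinity>"
    using assms bounded_set_imp_lmeasurable fmeasurableD2 by (metis infinity_ennreal_def top.not_eq_extremum)
  then show "emeasure (lebesgue_on S) (space (lebesgue_on S)) \<noteq> \<infinity>"
    using assms by (simp add: emeasure_restrict_space)
qed

lemma bounded_continuous_image:
  fixes f :: "'a::euclidean_space \<Rightarrow> 'b::euclidean_space"
  assumes "continuous_on UNIV f" "bounded S"
  shows "\<exists>B. \<forall>x\<in>S. norm (f x) \<le> B"
proof -
  have "compact (f ` closure S)"
    using assms by (meson compact_closure compact_continuous_image continuous_on_subset subset_UNIV)
  then obtain B where "\<forall>y\<in>f ` closure S. norm y \<le> B"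
    by (meson bounded_pos compact_imp_bounded)
  then show ?thesis using closure_subset[of S] by blast
qed

lemma measurable_lebesgue_on_continuous:
  fixes f :: "'a::euclidean_space \<Rightarrow> 'b::euclidean_space"
  assumes "continuous_on UNIV f"
  shows "f \<in> borel_measurable (lebesgue_on S)"
proof -
  have "f \<in> borel_measurable lebesgue"
    using borel_measurable_continuous_onI[OF assms] by (simp add: measurable_completion)
  then show ?thesis by (rule measurable_restrict_space1)
qed

lemma square_integrable_on_continuous:
  fixes f :: "'a::euclidean_space \<Rightarrow> 'b::euclidean_space"
  assumes f: "continuous_on UNIV f" and S: "bounded S" "S \<in> sets lebesgue"
  shows "f square_integrable_on S"
proof -
  interpret finite_measure "lebesgue_on S" by (rule finite_measure_lebesgue_on_bounded[OF S])
  note [measurable] = measurable_lebesgue_on_continuous[OF f]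
  obtain B where B: "\<forall>x\<in>S. norm (f x) \<le> B"
    using bounded_continuous_image[OF f S(1)] by blast
  have "integrable (lebesgue_on S) (\<lambda>x. (norm (f x))\<^sup>2)"
    by (rule integrable_const_bound[where B = "B\<^sup>2"]) (use B in \<open>auto intro!: power_mono\<close>)
  then show ?thesis by (simp add: square_integrable_on_def)
qed

text \<open>A test function \<open>\<phi>\<close> has compact support in \<open>S\<close>, so
  \<open>u x * \<phi> x\<close> is C1 with compact support and its gradient integrates to 0. The
  product rule splits this integral into the two sides of the weak gradient identity, and no
  boundary term arises.\<close>

lemma H1_with_gradient_C1:
  fixes u :: "'a::euclidean_space \<Rightarrow> real"
  assumes u: "\<And>x. GDERIV u x :> g x" and g: "continuous_on UNIV g"
    and S: "bounded S" "S \<in> sets lebesgue"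
  shows "H1_with_gradient S u g"
  unfolding H1_with_gradient_def weak_gradient_def
proof (intro conjI allI impI)
  have cu: "continuous_on UNIV u" by (rule GDERIV_continuous_on[OF u])
  show "u square_integrable_on S" "g square_integrable_on S"
    using cu g S by (auto intro: square_integrable_on_continuous)
  fix \<phi> \<psi> assume T: "test_function S \<phi> \<psi>"
  let ?K = "closure {x. \<phi> x \<noteq> 0}"
  have d: "\<And>x. GDERIV \<phi> x :> \<psi> x" and c\<psi>: "continuous_on UNIV \<psi>" and K: "compact ?K" "?K \<subseteq> S"
    using T by (auto simp: test_function_def)
  have c\<phi>: "continuous_on UNIV \<phi>" by (rule GDERIV_continuous_on[OF d])
  have 0: "\<phi> x = 0" "\<psi> x = 0" if "x \<notin> S" for x
  proof -
    have "x \<notin> ?K" using that K by blast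
    then show "\<psi> x = 0" using gradient_eq_0_outside_support[OF d] by blast
    show "\<phi> x = 0" using \<open>x \<notin> ?K\<close> closure_subset[of "{x. \<phi> x \<noteq> 0}"] by auto
  qed
  define k where "k x = u x *\<^sub>R \<psi> x + \<phi> x *\<^sub>R g x" for x
  have dk: "GDERIV (\<lambda>x. u x * \<phi> x) x :> k x" for x
    unfolding k_def by (rule GDERIV_mult[OF u d])
  have ck: "continuous_on UNIV k"
    unfolding k_def by (intro continuous_intros cu g c\<psi> c\<phi>)
  have "closure {x. u x * \<phi> x \<noteq> 0} \<subseteq> ?K" by (rule closure_mono) auto
  then have "compact (closure {x. u x * \<phi> x \<noteq> 0})"
    using compact_Int_closed[OF K(1) closed_closure, of "{x. u x * \<phi> x \<noteq> 0}"] by (simp add: Int_absorb1)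
  then have "integral\<^sup>L lborel k = 0" by (rule integral_gradient_eq_0[OF dk ck])
  moreover have "integral\<^sup>L (lebesgue_on S) k = integral\<^sup>L lborel k"
    by (rule integral_lebesgue_on_eq_lborel[OF ck S(2)]) (simp add: k_def 0)
  moreover have "integral\<^sup>L (lebesgue_on S) k =
      (LINT x|lebesgue_on S. u x *\<^sub>R \<psi> x) + (LINT x|lebesgue_on S. \<phi> x *\<^sub>R g x)"
    unfolding k_def
  proof (rule Bochner_Integration.integral_add)
    interpret finite_measure "lebesgue_on S" by (rule finite_measure_lebesgue_on_bounded[OF S])
    have "integrable (lebesgue_on S) f" if f: "continuous_on UNIV f" for f :: "'a \<Rightarrow> 'a"
    proof -
      obtain B where "\<forall>x\<in>S. norm (f x) \<le> B"
        using bounded_continuous_image[OF f S(1)] by blast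
      then show ?thesis
        by (intro integrable_const_bound[where B=B] measurable_lebesgue_on_continuous f) auto
    qed
    then show "integrable (lebesgue_on S) (\<lambda>x. u x *\<^sub>R \<psi> x)" "integrable (lebesgue_on S) (\<lambda>x. \<phi> x *\<^sub>R g x)"
      by (simp_all add: continuous_intros cu g c\<psi> c\<phi>)
  qed
  ultimately show "(LINT x|lebesgue_on S. u x *\<^sub>R \<psi> x) = - (LINT x|lebesgue_on S. \<phi> x *\<^sub>R g x)"
    by (simp add: eq_neg_iff_add_eq_0)
qed

subsection \<open>Neumann eigenfunctions of a ball\<close>

text \<open>A step given by a rational expression: the square makes it C1 at 1, it vanishes up to 1
  and tends to 1 at infinity. Evaluated at \<open>real (Suc n) * (1 - x \<bullet> x)\<close> it
  yields radial cutoffs that exhaust the unit ball.\<close>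

definition cutoff :: "real \<Rightarrow> real" where
  "cutoff z = (max 0 (z - 1))\<^sup>2 / (1 + (max 0 (z - 1))\<^sup>2)"

definition cutoff' :: "real \<Rightarrow> real" where
  "cutoff' z = 2 * max 0 (z - 1) / (1 + (max 0 (z - 1))\<^sup>2)\<^sup>2"

lemma DERIV_max_0_square: "((\<lambda>y. (max 0 y)\<^sup>2) has_real_derivative 2 * max 0 y) (at y)"
proof -
  consider "y < 0" | "y > 0" | "y = 0" by linarith
  then show ?thesis
  proof cases
    case 1
    have "((\<lambda>y. 0) has_real_derivative 0) (at y)" by simp
    then have "((\<lambda>y. (max 0 y)\<^sup>2) has_real_derivative 0) (at y)"
      by (rule has_field_derivative_transform_within_open[where S = "{..<0}"]) (use 1 in auto)
    then show ?thesis using 1 by simp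
  next
    case 2
    have "((\<lambda>y. y\<^sup>2) has_real_derivative 2 * y) (at y)" by (auto intro!: derivative_eq_intros)
    then have "((\<lambda>y. (max 0 y)\<^sup>2) has_real_derivative 2 * y) (at y)"
      by (rule has_field_derivative_transform_within_open[where S = "{0<..}"]) (use 2 in auto)
    then show ?thesis using 2 by simp
  next
    case 3
    have "((\<lambda>h. (max 0 h)\<^sup>2 / h) \<longlongrightarrow> 0) (at (0::real))"
    proof (rule Lim_null_comparison)
      show "\<forall>\<^sub>F h in at 0. norm ((max 0 h)\<^sup>2 / h) \<le> \<bar>h\<bar>"
        by (intro always_eventually allI) (auto simp: max_def power2_eq_square)
      show "((\<lambda>h. \<bar>h\<bar>) \<longlongrightarrow> 0) (at (0::real))"
        using tendsto_rabs[OF tendsto_ident_at[of "0::real" UNIV]] by simp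
    qed
    then show ?thesis using 3 by (simp add: DERIV_def)
  qed
qed

lemma cutoff_denominator_pos: "1 + (max 0 y)\<^sup>2 > (0::real)"
  by (simp add: add_pos_nonneg)

lemma DERIV_cutoff: "(cutoff has_real_derivative cutoff' z) (at z)"
proof -
  have "((\<lambda>z. z - 1) has_real_derivative 1) (at z)" by (auto intro!: derivative_eq_intros)
  from DERIV_chain2[OF DERIV_max_0_square[of "z - 1"] this]
  have 1: "((\<lambda>z. (max 0 (z - 1))\<^sup>2) has_real_derivative 2 * max 0 (z - 1)) (at z)" by simp
  have 2: "((\<lambda>w. w / (1 + w)) has_real_derivative 1 / (1 + w)\<^sup>2) (at w)" if "1 + w > 0" for w :: real
    using that by (auto intro!: derivative_eq_intros simp: power2_eq_square)
  show ?thesis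
    using DERIV_chain2[OF 2[OF cutoff_denominator_pos[of "z - 1"]] 1]
    unfolding cutoff_def[abs_def] cutoff'_def by simp
qed

lemma continuous_on_cutoff': "continuous_on UNIV cutoff'"
  unfolding cutoff'_def[abs_def]
  by (intro continuous_intros) (use cutoff_denominator_pos in \<open>auto simp: less_imp_neq[symmetric]\<close>)

lemma cutoff_eq_0: "z \<le> 1 \<Longrightarrow> cutoff z = 0"
  by (simp add: cutoff_def)

lemma cutoff_nonneg: "0 \<le> cutoff z"
  by (simp add: cutoff_def)

lemma cutoff_le_1: "cutoff z \<le> 1"
  using cutoff_denominator_pos[of "z - 1"] by (simp add: cutoff_def)

lemma cutoff'_nonneg: "0 \<le> cutoff' z"
  by (simp add: cutoff'_def)

lemma one_minus_cutoff: "1 - cutoff z = 1 / (1 + (max 0 (z - 1))\<^sup>2)"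
  using cutoff_denominator_pos[of "z - 1"] by (simp add: cutoff_def field_simps)

text \<open>By this bound \<open>n * cutoff' (n * q)\<close> is at most \<open>3 / q\<close>, which the Neumann condition, with
  \<open>q = 1 - |x|\<^sup>2\<close>, compensates.\<close>

lemma cutoff'_bound: "z * cutoff' z \<le> 3 * (1 - cutoff z)"
proof (cases "z \<ge> 1")
  case True
  define p where "p = z - 1"
  have p: "p \<ge> 0" "z = p + 1" using True by (auto simp: p_def)
  \<comment> \<open>The difference of the two sides of the next inequality is
    \<open>(p - 1)\<^sup>2 + 2\<close>.\<close>
  have "0 \<le> (p - 1)\<^sup>2" by simp
  then have "(p + 1) * (2 * p) \<le> 3 * (1 + p\<^sup>2)" by (simp add: power2_eq_square algebra_simps)
  moreover have "1 + p\<^sup>2 > 0" by (simp add: add_pos_nonneg)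
  ultimately have "(p + 1) * (2 * p) / (1 + p\<^sup>2)\<^sup>2 \<le> 3 * (1 + p\<^sup>2) / (1 + p\<^sup>2)\<^sup>2"
    by (intro divide_right_mono) auto
  also have "3 * (1 + p\<^sup>2) / (1 + p\<^sup>2)\<^sup>2 = 3 / (1 + p\<^sup>2)"
    using \<open>1 + p\<^sup>2 > 0\<close> nonzero_mult_divide_mult_cancel_right[of "1 + p\<^sup>2" 3 "1 + p\<^sup>2"]
    by (simp only: power2_eq_square[of "1 + p\<^sup>2"])
  finally show ?thesis unfolding one_minus_cutoff using p by (simp add: cutoff'_def max_def)
next
  case False
  then show ?thesis using cutoff_le_1[of z] by (simp add: cutoff'_def max_def)
qed

lemma one_minus_cutoff_le: "z > 0 \<Longrightarrow> 1 - cutoff z \<le> 2 / z"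
proof (cases "z \<ge> 1")
  case True
  \<comment> \<open>Completing the square: \<open>2 * (1 + (z - 1)\<^sup>2) - z\<close> equals
    \<open>2 * (z - 5/4)\<^sup>2 + 7/8\<close>.\<close>
  have "0 \<le> 2 * (z - 5/4)\<^sup>2" by simp
  then have "z \<le> 2 * (1 + (z - 1)\<^sup>2)" by (simp add: power2_eq_square algebra_simps)
  moreover have "1 + (z - 1)\<^sup>2 > 0" by (simp add: add_pos_nonneg)
  ultimately show ?thesis unfolding one_minus_cutoff using True by (simp add: max_def field_simps)
next
  case False
  assume "z > 0"
  then show ?thesis using False by (simp add: cutoff_def max_def field_simps)
qed

lemma cutoff_tendsto:
  assumes "q > 0"
  shows "(\<lambda>n. cutoff (real (Suc n) * q)) \<longlonglongrightarrow> 1"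
proof -
  have "(\<lambda>n. 1 - cutoff (real (Suc n) * q)) \<longlonglongrightarrow> 0"
  proof (rule Lim_null_comparison)
    show "\<forall>\<^sub>F n in sequentially. norm (1 - cutoff (real (Suc n) * q)) \<le> 2 / q * (1 / real (Suc n))"
    proof (intro always_eventually allI)
      fix n
      have "1 - cutoff (real (Suc n) * q) \<le> 2 / (real (Suc n) * q)"
        using assms by (intro one_minus_cutoff_le) simp
      then show "norm (1 - cutoff (real (Suc n) * q)) \<le> 2 / q * (1 / real (Suc n))"
        using cutoff_le_1[of "real (Suc n) * q"] by (simp add: mult.commute)
    qed
    show "(\<lambda>n. 2 / q * (1 / real (Suc n))) \<longlonglongrightarrow> 0"
      by (rule tendsto_mult_right_zero[OF LIMSEQ_Suc[OF lim_1_over_n]])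
  qed
  from tendsto_diff[OF tendsto_const[of 1] this] show ?thesis by simp
qed

section \<open>Products and components of square-integrable functions\<close>

lemma square_integrable_on_mult_integrable:
  fixes v w :: "'a::euclidean_space \<Rightarrow> real"
  assumes v: "v square_integrable_on S" and w: "w square_integrable_on S"
  shows "integrable (lebesgue_on S) (\<lambda>x. v x * w x)"
proof (rule Bochner_Integration.integrable_bound)
  note [measurable] = v[unfolded square_integrable_on_def, THEN conjunct1]
    w[unfolded square_integrable_on_def, THEN conjunct1]
  show "integrable (lebesgue_on S) (\<lambda>x. (norm (v x))\<^sup>2 + (norm (w x))\<^sup>2)"
    using v w by (simp add: square_integrable_on_def)
  show "(\<lambda>x. v x * w x) \<in> borel_measurable (lebesgue_on S)" by measurable
  have "\<bar>v x * w x\<bar> \<le> (v x)\<^sup>2 + (w x)\<^sup>2" for x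
  proof -
    have "2 * (\<bar>v x\<bar> * \<bar>w x\<bar>) \<le> (v x)\<^sup>2 + (w x)\<^sup>2"
      using sum_squares_bound[of "\<bar>v x\<bar>" "\<bar>w x\<bar>"] by simp
    moreover have "0 \<le> \<bar>v x\<bar> * \<bar>w x\<bar>" by (intro mult_nonneg_nonneg abs_ge_zero)
    ultimately show ?thesis unfolding abs_mult by linarith
  qed
  then show "AE x in lebesgue_on S. norm (v x * w x) \<le> norm ((norm (v x))\<^sup>2 + (norm (w x))\<^sup>2)"
    by simp
qed

lemma square_integrable_on_inner:
  assumes "h square_integrable_on S"
  shows "(\<lambda>x. h x \<bullet> i) square_integrable_on S"
  unfolding square_integrable_on_def
proof
  note [measurable] = assms[unfolded square_integrable_on_def, THEN conjunct1]
  show "(\<lambda>x. h x \<bullet> i) \<in> borel_measurable (lebesgue_on S)" by measurable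
  show "integrable (lebesgue_on S) (\<lambda>x. (norm (h x \<bullet> i))\<^sup>2)"
  proof (rule Bochner_Integration.integrable_bound)
    show "integrable (lebesgue_on S) (\<lambda>x. (norm i)\<^sup>2 * (norm (h x))\<^sup>2)"
      using assms by (simp add: square_integrable_on_def)
    have "(norm (h x \<bullet> i))\<^sup>2 \<le> (norm i)\<^sup>2 * (norm (h x))\<^sup>2" for x
      using power_mono[OF Cauchy_Schwarz_ineq2[of "h x" i], of 2]
      by (simp add: power_mult_distrib mult.commute)
    then show "AE x in lebesgue_on S. norm ((norm (h x \<bullet> i))\<^sup>2) \<le> norm ((norm i)\<^sup>2 * (norm (h x))\<^sup>2)"
      by simp
  qed measurable
qed

lemma integrable_eucl_component:
  fixes f :: "'c \<Rightarrow> 'a::euclidean_space"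
  assumes "\<And>i. i \<in> Basis \<Longrightarrow> integrable M (\<lambda>x. f x \<bullet> i)"
  shows "integrable M f"
proof -
  have "integrable M (\<lambda>x. \<Sum>i\<in>Basis. (f x \<bullet> i) *\<^sub>R i)"
    using assms by (intro Bochner_Integration.integrable_sum integrable_scaleR_left) auto
  then show ?thesis by (simp add: euclidean_representation)
qed

text \<open>\<open>R i\<close> is the gradient of the \<open>i\<close>-th component of the gradient
  \<open>g\<close>, so \<open>laplace\<close> reads -\<Delta>u = t u. The hypothesis
  \<open>neumann\<close> is a quantitative Neumann condition: the radial derivative vanishes at
  least linearly towards the sphere, which offsets the growth of the cutoff gradients.\<close>

lemma neumann_eigenspace_ballI:
  fixes u :: "'a::euclidean_space \<Rightarrow> real"
  assumes u: "\<And>x. GDERIV u x :> g x"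
    and g: "\<And>x i. i \<in> Basis \<Longrightarrow> GDERIV (\<lambda>y. g y \<bullet> i) x :> R i x"
    and R: "\<And>i. i \<in> Basis \<Longrightarrow> continuous_on UNIV (R i)"
    and laplace: "\<And>x. (\<Sum>i\<in>Basis. R i x \<bullet> i) = - t * u x"
    and neumann: "\<And>x. x \<in> ball 0 1 \<Longrightarrow> \<bar>x \<bullet> g x\<bar> \<le> C * (1 - x \<bullet> x)"
  shows "u \<in> neumann_eigenspace (ball 0 1) t"
proof -
  let ?S = "ball (0::'a) 1"
  let ?M = "lebesgue_on ?S"
  have S: "bounded ?S" "?S \<in> sets lebesgue" by auto
  have cgi: "continuous_on UNIV (\<lambda>x. g x \<bullet> i)" if "i \<in> Basis" for i
    by (rule GDERIV_continuous_on[OF g[OF that]])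
  have cg: "continuous_on UNIV g" using cgi by (subst continuous_on_componentwise) auto
  have cu: "continuous_on UNIV u" by (rule GDERIV_continuous_on[OF u])
  have S1: "x \<bullet> x < 1" if "x \<in> ?S" for x
    using that by (simp add: norm_lt_square) 
  have H: "H1_with_gradient ?S u g" by (rule H1_with_gradient_C1[OF u cg S])
  have "(LINT x|?M. g x \<bullet> h x) = t * (LINT x|?M. u x * v x)" if vh: "H1_with_gradient ?S v h" for v h
  proof -
    have v2: "v square_integrable_on ?S" and h2: "h square_integrable_on ?S"
      and wg: "weak_gradient ?S v h" using vh by (auto simp: H1_with_gradient_def)
    have vi: "integrable ?M (\<lambda>x. v x * f x)" if "continuous_on UNIV f" for f
      by (rule square_integrable_on_mult_integrable[OF v2 square_integrable_on_continuous[OF that S]])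
    have hi: "integrable ?M (\<lambda>x. f x * (h x \<bullet> i))" if "continuous_on UNIV f" for f i
      by (rule square_integrable_on_mult_integrable
          [OF square_integrable_on_continuous[OF that S] square_integrable_on_inner[OF h2]])
    define \<eta> where "\<eta> n x = cutoff (real (Suc n) * (1 - x \<bullet> x))" for n and x :: 'a
    define \<zeta> where "\<zeta> n x = (- 2 * real (Suc n) * cutoff' (real (Suc n) * (1 - x \<bullet> x))) *\<^sub>R x" for n and x :: 'a
    have \<eta>: "GDERIV (\<eta> n) x :> \<zeta> n x" for n x
    proof -
      have "((\<lambda>x. real (Suc n) * (1 - x \<bullet> x)) has_derivative (\<lambda>h. h \<bullet> ((- 2 * real (Suc n)) *\<^sub>R x))) (at x)"
        by (auto intro!: derivative_eq_intros simp: inner_commute algebra_simps)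
      from GDERIV_DERIV_compose[OF this[folded gderiv_def] DERIV_cutoff]
      show ?thesis unfolding \<eta>_def \<zeta>_def by (simp add: mult.commute)
    qed
    have c\<eta>: "continuous_on UNIV (\<eta> n)" for n by (rule GDERIV_continuous_on[OF \<eta>])
    have c\<zeta>: "continuous_on UNIV (\<zeta> n)" for n
      unfolding \<zeta>_def by (intro continuous_intros continuous_on_compose2[OF continuous_on_cutoff']) auto
    \<comment> \<open>The test functions are \<open>\<eta> n x * (g x \<bullet> i)\<close>, with
      gradients \<open>\<psi> i\<close>. The \<open>i\<close>-th components of the weak gradient
      identities add up to the claim, because the divergence of
      \<open>\<eta> n x *\<^sub>R g x\<close> is
      \<open>\<eta> n x * (- t * u x) + \<zeta> n x \<bullet> g x\<close>.\<close>
    have key: "(LINT x|?M. \<eta> n x * (g x \<bullet> h x)) =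
        (LINT x|?M. t * (\<eta> n x * (v x * u x)) - v x * (\<zeta> n x \<bullet> g x))" for n
    proof -
      define \<psi> where "\<psi> i x = \<eta> n x *\<^sub>R R i x + (g x \<bullet> i) *\<^sub>R \<zeta> n x" for i x
      have c\<psi>: "continuous_on UNIV (\<psi> i)" if "i \<in> Basis" for i
        unfolding \<psi>_def by (intro continuous_intros c\<eta> c\<zeta> R cgi that)
      have i: "(LINT x|?M. v x * (\<psi> i x \<bullet> i)) = - (LINT x|?M. (\<eta> n x * (g x \<bullet> i)) * (h x \<bullet> i))"
        if i: "i \<in> Basis" for i
      proof -
        let ?\<phi> = "\<lambda>x. \<eta> n x * (g x \<bullet> i)"
        \<comment> \<open>Since \<open>cutoff\<close> vanishes up to 1, this compact subset of the
          ball contains the support of the test function.\<close>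
        define K where "K = {x::'a. real (Suc n) * (1 - x \<bullet> x) \<ge> 1}"
        have K1: "K \<subseteq> ?S"
        proof
          fix x assume "x \<in> K"
          then have "1 \<le> real (Suc n) * (1 - x \<bullet> x)" by (simp add: K_def)
          then have "x \<bullet> x < 1"
            by (metis diff_gt_0_iff_gt less_le_trans of_nat_0_less_iff zero_less_Suc zero_less_mult_pos zero_less_one)
          then show "x \<in> ?S" by (simp add: norm_lt_square)
        qed
        have "closed K" unfolding K_def by (intro closed_Collect_le continuous_intros)
        then have "compact K" using K1 by (metis bounded_ball bounded_subset compact_eq_bounded_closed)
        have "closure {x. ?\<phi> x \<noteq> 0} \<subseteq> K"
          using \<open>closed K\<close> by (intro closure_minimal) (auto simp: K_def \<eta>_def intro: linear cutoff_eq_0)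
        moreover have "compact (closure {x. ?\<phi> x \<noteq> 0})"
          using \<open>compact K\<close> calculation by (metis Int_absorb1 closed_closure compact_Int_closed)
        moreover have "GDERIV ?\<phi> x :> \<psi> i x" for x
          unfolding \<psi>_def by (rule GDERIV_mult[OF \<eta> g[OF i]])
        ultimately have "test_function ?S ?\<phi> (\<psi> i)"
          using K1 c\<psi>[OF i] unfolding test_function_def by blast
        then have "(LINT x|?M. v x *\<^sub>R \<psi> i x) = - (LINT x|?M. ?\<phi> x *\<^sub>R h x)"
          using wg unfolding weak_gradient_def by blast
        then have "(LINT x|?M. v x *\<^sub>R \<psi> i x) \<bullet> i = - (LINT x|?M. ?\<phi> x *\<^sub>R h x) \<bullet> i" by simp
        moreover have "integrable ?M (\<lambda>x. v x *\<^sub>R \<psi> i x)"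
          by (rule integrable_eucl_component) (simp, intro vi continuous_intros c\<psi> i)
        moreover have "integrable ?M (\<lambda>x. ?\<phi> x *\<^sub>R h x)"
          by (rule integrable_eucl_component) (simp, intro hi continuous_intros c\<eta> cgi i)
        ultimately show ?thesis
          by (simp flip: integral_inner_left)
      qed
      have "(LINT x|?M. \<eta> n x * (g x \<bullet> h x)) = (LINT x|?M. (\<Sum>i\<in>Basis. (\<eta> n x * (g x \<bullet> i)) * (h x \<bullet> i)))"
        by (subst euclidean_inner) (simp add: sum_distrib_left mult.assoc)
      also have "\<dots> = (\<Sum>i\<in>Basis. LINT x|?M. (\<eta> n x * (g x \<bullet> i)) * (h x \<bullet> i))"
        by (rule Bochner_Integration.integral_sum) (intro hi continuous_intros c\<eta> cgi)
      also have "\<dots> = (\<Sum>i\<in>Basis. - (LINT x|?M. v x * (\<psi> i x \<bullet> i)))"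
        by (rule sum.cong) (simp_all add: i)
      also have "\<dots> = - (\<Sum>i\<in>Basis. LINT x|?M. v x * (\<psi> i x \<bullet> i))"
        by (rule sum_negf)
      also have "(\<Sum>i\<in>Basis. LINT x|?M. v x * (\<psi> i x \<bullet> i)) = (LINT x|?M. (\<Sum>i\<in>Basis. v x * (\<psi> i x \<bullet> i)))"
        by (rule Bochner_Integration.integral_sum[symmetric]) (intro vi continuous_intros c\<psi>)
      also have "- \<dots> = (LINT x|?M. - (\<Sum>i\<in>Basis. v x * (\<psi> i x \<bullet> i)))" by simp
      also have "\<dots> = (LINT x|?M. t * (\<eta> n x * (v x * u x)) - v x * (\<zeta> n x \<bullet> g x))"
      proof (rule Bochner_Integration.integral_cong[OF refl])
        fix x
        have "(\<Sum>i\<in>Basis. \<psi> i x \<bullet> i) = \<eta> n x * (\<Sum>i\<in>Basis. R i x \<bullet> i) + (\<Sum>i\<in>Basis. (\<zeta> n x \<bullet> i) * (g x \<bullet> i))"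
          by (simp add: \<psi>_def inner_add_left sum.distrib sum_distrib_left mult.commute)
        also have "\<dots> = \<eta> n x * (- t * u x) + \<zeta> n x \<bullet> g x"
          unfolding laplace by (subst (2) euclidean_inner) (rule refl)
        finally have "(\<Sum>i\<in>Basis. v x * (\<psi> i x \<bullet> i)) = v x * (\<eta> n x * (- t * u x) + \<zeta> n x \<bullet> g x)"
          by (simp add: sum_distrib_left[symmetric])
        then show "- (\<Sum>i\<in>Basis. v x * (\<psi> i x \<bullet> i)) = t * (\<eta> n x * (v x * u x)) - v x * (\<zeta> n x \<bullet> g x)"
          by (simp add: algebra_simps)
      qed
      finally show ?thesis .
    qed
    have \<eta>1: "(\<lambda>n. \<eta> n x) \<longlonglongrightarrow> 1" if "x \<in> ?S" for x
      unfolding \<eta>_def by (rule cutoff_tendsto) (use S1[OF that] in simp)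
    have \<eta>01: "\<bar>\<eta> n x\<bar> \<le> 1" for n x
      unfolding \<eta>_def using cutoff_nonneg cutoff_le_1 by (simp add: abs_le_iff order_trans[of _ 0])
    \<comment> \<open>The factor \<open>real (Suc n)\<close> in \<open>\<zeta> n x\<close> is paired
      with the factor \<open>1 - x \<bullet> x\<close> from \<open>neumann\<close>, and
      \<open>cutoff'_bound\<close> turns the product into a multiple of
      \<open>1 - \<eta> n x\<close>. This gives at once a bound uniform in \<open>n\<close> and
      pointwise convergence to 0.\<close>
    have bound: "\<bar>\<zeta> n x \<bullet> g x\<bar> \<le> 6 * \<bar>C\<bar> * (1 - \<eta> n x)" if x: "x \<in> ?S" for n x
    proof -
      let ?z = "real (Suc n) * (1 - x \<bullet> x)"
      have q: "1 - x \<bullet> x > 0" using S1[OF x] by simp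
      have "\<bar>\<zeta> n x \<bullet> g x\<bar> = 2 * (real (Suc n) * cutoff' ?z) * \<bar>x \<bullet> g x\<bar>"
        using cutoff'_nonneg[of ?z] by (simp add: \<zeta>_def abs_mult del: of_nat_Suc)
      also have "\<dots> \<le> 2 * (real (Suc n) * cutoff' ?z) * (\<bar>C\<bar> * (1 - x \<bullet> x))"
      proof (rule mult_left_mono)
        have "C * (1 - x \<bullet> x) \<le> \<bar>C\<bar> * (1 - x \<bullet> x)" using q by (intro mult_right_mono) auto
        then show "\<bar>x \<bullet> g x\<bar> \<le> \<bar>C\<bar> * (1 - x \<bullet> x)" using neumann[OF x] by linarith
      qed (use cutoff'_nonneg[of ?z] in simp)
      also have "\<dots> = 2 * \<bar>C\<bar> * (?z * cutoff' ?z)" by (simp only: mult_ac)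
      also have "\<dots> \<le> 2 * \<bar>C\<bar> * (3 * (1 - cutoff ?z))"
        by (intro mult_left_mono cutoff'_bound) auto
      finally show ?thesis by (simp add: \<eta>_def mult_ac)
    qed
    have gh: "integrable ?M (\<lambda>x. g x \<bullet> h x)"
      by (subst euclidean_inner) (intro Bochner_Integration.integrable_sum hi cgi)
    have vI: "integrable ?M v" using vi[of "\<lambda>_. 1"] by simp
    have vu: "integrable ?M (\<lambda>x. v x * u x)" by (rule vi[OF cu])
    note [measurable] = borel_measurable_integrable[OF gh] borel_measurable_integrable[OF vI]
      measurable_lebesgue_on_continuous[OF c\<eta>] measurable_lebesgue_on_continuous[OF cu]
      measurable_lebesgue_on_continuous[OF c\<zeta>] measurable_lebesgue_on_continuous[OF cg]
    have L1: "(\<lambda>n. LINT x|?M. \<eta> n x * (g x \<bullet> h x)) \<longlonglongrightarrow> (LINT x|?M. g x \<bullet> h x)"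
    proof (rule integral_dominated_convergence[where w = "\<lambda>x. \<bar>g x \<bullet> h x\<bar>"])
      show "AE x in ?M. (\<lambda>n. \<eta> n x * (g x \<bullet> h x)) \<longlonglongrightarrow> g x \<bullet> h x"
        by (rule AE_I2) (use tendsto_mult_right[OF \<eta>1] in fastforce)
      show "AE x in ?M. norm (\<eta> n x * (g x \<bullet> h x)) \<le> \<bar>g x \<bullet> h x\<bar>" for n
        by (rule AE_I2) (use \<eta>01 in \<open>simp add: abs_mult mult_left_le_one_le\<close>)
      show "integrable ?M (\<lambda>x. \<bar>g x \<bullet> h x\<bar>)" using gh by simp
    qed measurable
    have L2: "(\<lambda>n. LINT x|?M. t * (\<eta> n x * (v x * u x)) - v x * (\<zeta> n x \<bullet> g x))
        \<longlonglongrightarrow> (LINT x|?M. t * (v x * u x))"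
    proof (rule integral_dominated_convergence[where w = "\<lambda>x. \<bar>t\<bar> * \<bar>v x * u x\<bar> + 12 * \<bar>C\<bar> * \<bar>v x\<bar>"])
      show "AE x in ?M. (\<lambda>n. t * (\<eta> n x * (v x * u x)) - v x * (\<zeta> n x \<bullet> g x)) \<longlonglongrightarrow> t * (v x * u x)"
      proof (rule AE_I2)
        fix x assume "x \<in> space ?M"
        then have x: "x \<in> ?S" by simp
        have "(\<lambda>n. \<zeta> n x \<bullet> g x) \<longlonglongrightarrow> 0"
        proof (rule Lim_null_comparison)
          show "\<forall>\<^sub>F n in sequentially. norm (\<zeta> n x \<bullet> g x) \<le> 6 * \<bar>C\<bar> * (1 - \<eta> n x)"
            using bound[OF x] by simp
          show "(\<lambda>n. 6 * \<bar>C\<bar> * (1 - \<eta> n x)) \<longlonglongrightarrow> 0"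
            using tendsto_mult_right_zero[OF tendsto_diff[OF tendsto_const[of 1] \<eta>1[OF x], simplified]] .
        qed
        from tendsto_diff[OF tendsto_mult[OF tendsto_const[of t] tendsto_mult[OF \<eta>1[OF x] tendsto_const[of "v x * u x"]]]
            tendsto_mult[OF tendsto_const[of "v x"] this]]
        show "(\<lambda>n. t * (\<eta> n x * (v x * u x)) - v x * (\<zeta> n x \<bullet> g x)) \<longlonglongrightarrow> t * (v x * u x)" by simp
      qed
      show "AE x in ?M. norm (t * (\<eta> n x * (v x * u x)) - v x * (\<zeta> n x \<bullet> g x))
          \<le> \<bar>t\<bar> * \<bar>v x * u x\<bar> + 12 * \<bar>C\<bar> * \<bar>v x\<bar>" for n
      proof (rule AE_I2)
        fix x assume "x \<in> space ?M"
        then have x: "x \<in> ?S" by simp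
        have "\<bar>t * (\<eta> n x * (v x * u x))\<bar> = \<bar>\<eta> n x\<bar> * (\<bar>t\<bar> * \<bar>v x * u x\<bar>)" by (simp add: abs_mult)
        also have "\<dots> \<le> \<bar>t\<bar> * \<bar>v x * u x\<bar>" using \<eta>01 by (intro mult_left_le_one_le) auto
        finally have 1: "\<bar>t * (\<eta> n x * (v x * u x))\<bar> \<le> \<bar>t\<bar> * \<bar>v x * u x\<bar>" .
        have "6 * \<bar>C\<bar> * (1 - \<eta> n x) \<le> 6 * \<bar>C\<bar> * 2"
          by (rule mult_left_mono) (use \<eta>01[of n x] in auto)
        then have "\<bar>\<zeta> n x \<bullet> g x\<bar> \<le> 12 * \<bar>C\<bar>" using bound[OF x, of n] by linarith
        then have "\<bar>v x * (\<zeta> n x \<bullet> g x)\<bar> \<le> 12 * \<bar>C\<bar> * \<bar>v x\<bar>"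
          by (simp add: abs_mult mult.commute mult_left_mono)
        with 1 show "norm (t * (\<eta> n x * (v x * u x)) - v x * (\<zeta> n x \<bullet> g x))
            \<le> \<bar>t\<bar> * \<bar>v x * u x\<bar> + 12 * \<bar>C\<bar> * \<bar>v x\<bar>"
          unfolding real_norm_def by linarith
      qed
      show "integrable ?M (\<lambda>x. \<bar>t\<bar> * \<bar>v x * u x\<bar> + 12 * \<bar>C\<bar> * \<bar>v x\<bar>)"
        using vu vI by simp
    qed measurable
    have "(LINT x|?M. g x \<bullet> h x) = (LINT x|?M. t * (v x * u x))"
      using L1 L2 unfolding key by (rule LIMSEQ_unique)
    then show ?thesis by (simp add: mult.commute[of "v _"])
  qed
  with H show ?thesis unfolding neumann_eigenspace_def by blast
qed

subsection \<open>Bessel functions\<close>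

definition bessel_coeff :: "nat \<Rightarrow> nat \<Rightarrow> real" where
  "bessel_coeff m n = (-1) ^ n / (fact n * fact (n + m))"

text \<open>\<open>J\<^sub>m r = (r / 2)\<^sup>m * bessel_clifford m (r\<^sup>2 / 4)\<close>\<close>

definition bessel_clifford :: "nat \<Rightarrow> real \<Rightarrow> real" where
  "bessel_clifford m s = (\<Sum>n. bessel_coeff m n * s ^ n)"

text \<open>\<open>r * J\<^sub>m' r = (r / 2)\<^sup>m * neumann_clifford m (r\<^sup>2 / 4)\<close>\<close>

definition neumann_clifford :: "nat \<Rightarrow> real \<Rightarrow> real" where
  "neumann_clifford m s = real m * bessel_clifford m s - 2 * s * bessel_clifford (Suc m) s"

lemma summable_bessel: "summable (\<lambda>n. bessel_coeff m n * s ^ n)"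
proof (rule summable_comparison_test')
  show "summable (\<lambda>n. inverse (fact n) * \<bar>s\<bar> ^ n)" by (rule summable_exp)
  fix n
  have "(1::real) \<le> fact (n + m)" by (rule fact_ge_1)
  then have "\<bar>s\<bar> ^ n / (fact n * fact (n + m)) \<le> \<bar>s\<bar> ^ n / (fact n * 1)"
    by (intro divide_left_mono mult_left_mono) auto
  then show "norm (bessel_coeff m n * s ^ n) \<le> inverse (fact n) * \<bar>s\<bar> ^ n"
    by (simp add: bessel_coeff_def abs_mult power_abs inverse_eq_divide)
qed

lemma bessel_coeff_0: "bessel_coeff m 0 = 1 / fact m"
  by (simp add: bessel_coeff_def)

lemma diffs_bessel_coeff: "diffs (bessel_coeff m) n = - bessel_coeff (Suc m) n"
  by (simp add: diffs_def bessel_coeff_def field_simps del: of_nat_Suc)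

lemma DERIV_bessel_clifford:
  "(bessel_clifford m has_real_derivative - bessel_clifford (Suc m) s) (at s)"
  using termdiffs_strong_converges_everywhere[OF summable_bessel, of m s]
  unfolding bessel_clifford_def[abs_def] diffs_bessel_coeff
  by (simp add: suminf_minus[OF summable_bessel])

lemma continuous_on_bessel_clifford: "continuous_on UNIV (bessel_clifford m)"
  by (meson DERIV_bessel_clifford DERIV_isCont continuous_at_imp_continuous_on)

lemma bessel_clifford_0: "bessel_clifford m 0 = 1 / fact m"
  unfolding bessel_clifford_def
  using suminf_finite[of "{0}" "\<lambda>n. bessel_coeff m n * 0 ^ n"] by (simp add: bessel_coeff_0)

text \<open>This is Bessel's equation: as the derivative of \<open>bessel_clifford m\<close> is
  \<open>- bessel_clifford (Suc m)\<close>, it says s F'' + (m + 1) F' + F = 0 for F =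
  \<open>bessel_clifford m\<close>. The coefficients are compared after splitting off the constant
  terms.\<close>

lemma bessel_clifford_recurrence:
  "s * bessel_clifford (Suc (Suc m)) s - real (Suc m) * bessel_clifford (Suc m) s + bessel_clifford m s = 0"
proof -
  define f where "f m n = bessel_coeff m n * s ^ n" for m n
  have sf: "summable (f m)" "bessel_clifford m s = suminf (f m)" for m
    unfolding f_def bessel_clifford_def by (auto intro: summable_bessel)
  have head: "bessel_clifford m s = 1 / fact m + (\<Sum>n. f m (Suc n))" for m
    using suminf_split_head[OF sf(1), of m] by (simp add: sf(2) f_def bessel_coeff_0)
  have ss: "summable (\<lambda>n. f m (Suc n))" for m
    using sf(1)[of m] by (subst summable_Suc_iff)
  have coeff: "real (Suc m) * f (Suc m) (Suc n) = s * f (Suc (Suc m)) n + f m (Suc n)" for n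
    by (simp add: f_def bessel_coeff_def divide_simps) (simp add: algebra_simps)
  have "real (Suc m) * (\<Sum>n. f (Suc m) (Suc n)) = (\<Sum>n. real (Suc m) * f (Suc m) (Suc n))"
    by (rule suminf_mult[OF ss, symmetric])
  also have "\<dots> = (\<Sum>n. s * f (Suc (Suc m)) n) + (\<Sum>n. f m (Suc n))"
    unfolding coeff by (rule suminf_add[OF summable_mult[OF sf(1)] ss, symmetric])
  also have "(\<Sum>n. s * f (Suc (Suc m)) n) = s * bessel_clifford (Suc (Suc m)) s"
    unfolding sf(2) by (rule suminf_mult[OF sf(1)])
  finally show ?thesis
    unfolding head[of m] head[of "Suc m"] by (simp add: field_simps del: of_nat_Suc)
qed

text \<open>The terms of the series of \<open>bessel_clifford m\<close> after applying the operator
  m + 2 s d/ds, which multiplies s^n by m + 2 n.\<close>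

definition neumann_term :: "nat \<Rightarrow> real \<Rightarrow> nat \<Rightarrow> real" where
  "neumann_term m s n = (-1) ^ n * real (m + 2 * n) * s ^ n / (fact n * fact (n + m))"

lemma neumann_clifford_sums: "neumann_term m s sums neumann_clifford m s"
proof -
  have "(\<lambda>n. s * (bessel_coeff (Suc m) n * s ^ n)) sums (s * bessel_clifford (Suc m) s)"
    unfolding bessel_clifford_def by (intro sums_mult summable_sums summable_bessel)
  moreover have "s * (bessel_coeff (Suc m) n * s ^ n) = - (real (Suc n) * bessel_coeff m (Suc n) * s ^ Suc n)" for n
    by (simp add: bessel_coeff_def divide_simps)
  ultimately have "(\<lambda>n. - (real (Suc n) * bessel_coeff m (Suc n) * s ^ Suc n)) sums (s * bessel_clifford (Suc m) s)"
    by simp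
  from sums_minus[OF this]
  have "(\<lambda>n. real (Suc n) * bessel_coeff m (Suc n) * s ^ Suc n) sums (- (s * bessel_clifford (Suc m) s))"
    by simp
  \<comment> \<open>The term with \<open>n = 0\<close> is 0, so the index shift adds nothing to the
    sum.\<close>
  then have "(\<lambda>n. real n * bessel_coeff m n * s ^ n) sums (- (s * bessel_clifford (Suc m) s))"
    by (subst (asm) sums_Suc_iff) simp
  from sums_add[OF sums_mult[OF summable_sums[OF summable_bessel[of m s]], of "real m"] sums_mult[OF this, of 2]]
  have "(\<lambda>n. real m * (bessel_coeff m n * s ^ n) + 2 * (real n * bessel_coeff m n * s ^ n)) sums neumann_clifford m s"
    by (simp add: neumann_clifford_def bessel_clifford_def algebra_simps)
  moreover have "real m * (bessel_coeff m n * s ^ n) + 2 * (real n * bessel_coeff m n * s ^ n) = neumann_term m s n" for n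
    by (simp add: neumann_term_def bessel_coeff_def algebra_simps add_divide_distrib)
  ultimately show ?thesis by simp
qed

lemma DERIV_neumann_clifford:
  "(neumann_clifford m has_real_derivative
     (2 * s * bessel_clifford (Suc (Suc m)) s - real (m + 2) * bessel_clifford (Suc m) s)) (at s)"
  unfolding neumann_clifford_def[abs_def]
  by (auto intro!: derivative_eq_intros DERIV_bessel_clifford simp: algebra_simps)

lemma continuous_on_neumann_clifford: "continuous_on S (neumann_clifford m)"
  by (meson DERIV_neumann_clifford DERIV_isCont continuous_at_imp_continuous_on)

text \<open>Mean value theorem between \<open>q\<close> and 1, with a derivative that is bounded on
  the unit interval. For \<open>q = x \<bullet> x\<close> this is the linear decay that
  \<open>neumann_eigenspace_ballI\<close> asks for.\<close>

lemma neumann_clifford_lipschitz_at_zero: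
  assumes "neumann_clifford m s = 0"
  shows "\<exists>B. \<forall>q\<in>{0..1}. \<bar>neumann_clifford m (s * q)\<bar> \<le> B * (1 - q)"
proof -
  define D where "D q = s * (2 * (s * q) * bessel_clifford (Suc (Suc m)) (s * q) - real (m + 2) * bessel_clifford (Suc m) (s * q))" for q
  have d: "((\<lambda>q. neumann_clifford m (s * q)) has_real_derivative D q) (at q)" for q
  proof -
    have "((\<lambda>q. s * q) has_real_derivative s) (at q)" by (auto intro!: derivative_eq_intros)
    from DERIV_chain2[OF DERIV_neumann_clifford this]
    show ?thesis by (simp add: D_def mult.commute)
  qed
  have "continuous_on UNIV D"
    unfolding D_def by (intro continuous_intros continuous_on_compose2[OF continuous_on_bessel_clifford]) auto
  then obtain B where B: "\<forall>q\<in>{0..1}. norm (D q) \<le> B"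
    using bounded_continuous_image[of D "{0..1}"] bounded_closed_interval by blast
  have "\<bar>neumann_clifford m (s * q)\<bar> \<le> B * (1 - q)" if q: "q \<in> {0..1}" for q
  proof (cases "q = 1")
    case False
    then have "q < 1" using q by simp
    from MVT2[OF this d] obtain z where z: "q < z" "z < 1"
      "neumann_clifford m (s * 1) - neumann_clifford m (s * q) = (1 - q) * D z" by blast
    then have "\<bar>neumann_clifford m (s * q)\<bar> = (1 - q) * \<bar>D z\<bar>"
      using z(3) assms \<open>q < 1\<close> abs_mult[of "1 - q" "D z"] by (simp add: abs_minus_commute)
    also have "\<dots> \<le> (1 - q) * B" using B z q \<open>q < 1\<close> by (intro mult_left_mono) auto
    finally show ?thesis by (simp add: mult.commute)
  qed (use assms in simp)
  then show ?thesis by blast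
qed

text \<open>From index \<open>N\<close> on each term is at most half of the preceding one in
  absolute value: the factor \<open>m + 2 * n\<close> at most doubles, and
  \<open>4 * s \<le> (real (N + 1))\<^sup>2\<close> bounds the remaining quotient by 1/4. The tail
  is dominated by a geometric series with sum
  \<open>2 * \<bar>neumann_term m s N\<bar>\<close>.\<close>

lemma neumann_clifford_partial_sum:
  assumes s: "0 \<le> s" and N: "0 < N" "4 * s \<le> (real (N + 1))\<^sup>2"
  shows "\<bar>neumann_clifford m s - (\<Sum>n<N. neumann_term m s n)\<bar> \<le> 2 * \<bar>neumann_term m s N\<bar>"
proof -
  let ?a = "neumann_term m s"
  have ratio: "\<bar>?a (Suc n)\<bar> \<le> \<bar>?a n\<bar> / 2" if n: "N \<le> n" for n
  proof -
    have *: "\<bar>?a n\<bar> = real (m + 2 * n) * s ^ n / (fact n * fact (n + m))" for n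
      using s by (simp add: neumann_term_def abs_mult)
    have "(real (N + 1))\<^sup>2 \<le> real (n + 1) * real (n + m + 1)"
      unfolding power2_eq_square using n by (intro mult_mono) auto
    then have 1: "4 * s \<le> real (n + 1) * real (n + m + 1)" using N by linarith
    have 2: "real (m + 2 * Suc n) \<le> 2 * real (m + 2 * n)" using n N by simp
    have "real (m + 2 * Suc n) * s * 2 \<le> 2 * real (m + 2 * n) * s * 2"
      using 2 s by (intro mult_right_mono) auto
    also have "\<dots> = real (m + 2 * n) * (4 * s)" by simp
    also have "\<dots> \<le> real (m + 2 * n) * (real (n + 1) * real (n + m + 1))"
      using 1 by (intro mult_left_mono) auto
    finally have "real (m + 2 * Suc n) * s \<le> real (m + 2 * n) / 2 * (real (n + 1) * real (n + m + 1))"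
      by linarith
    then have "real (m + 2 * Suc n) * s / (real (n + 1) * real (n + m + 1)) \<le> real (m + 2 * n) / 2"
      by (subst pos_divide_le_eq) auto
    then have "real (m + 2 * Suc n) * s / (real (n + 1) * real (n + m + 1)) * (s ^ n / (fact n * fact (n + m)))
        \<le> real (m + 2 * n) / 2 * (s ^ n / (fact n * fact (n + m)))"
      using s by (intro mult_right_mono) auto
    then show ?thesis unfolding * by (simp add: mult_ac)
  qed
  have geo: "\<bar>?a (n + N)\<bar> \<le> \<bar>?a N\<bar> * (1/2) ^ n" for n
  proof (induction n)
    case (Suc n)
    then show ?case using ratio[of "n + N"] by simp
  qed simp
  have sum: "summable ?a" "suminf ?a = neumann_clifford m s"
    using neumann_clifford_sums[of m s] sums_summable sums_unique by force+
  have gs: "summable (\<lambda>n. \<bar>?a N\<bar> * (1/2) ^ n)" by (intro summable_mult summable_geometric) simp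
  have "neumann_clifford m s - (\<Sum>n<N. ?a n) = (\<Sum>n. ?a (n + N))"
    using suminf_minus_initial_segment[OF sum(1), of N] sum(2) by simp
  also have "\<bar>\<dots>\<bar> \<le> (\<Sum>n. \<bar>?a N\<bar> * (1/2) ^ n)"
    using norm_suminf_le[OF _ gs, of "\<lambda>n. ?a (n + N)"] geo by simp
  also have "\<dots> = 2 * \<bar>?a N\<bar>"
    using suminf_mult[OF summable_geometric[of "1/2::real"], of "\<bar>?a N\<bar>"] suminf_geometric[of "1/2::real"] by simp
  finally show ?thesis .
qed

text \<open>At a rational point this makes the sign a finite computation with fractions.\<close>

lemma neumann_clifford_pos:
  assumes "0 \<le> s" "0 < N" "4 * s \<le> (real (N + 1))\<^sup>2"
    and "2 * \<bar>neumann_term m s N\<bar> < (\<Sum>n<N. neumann_term m s n)"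
  shows "0 < neumann_clifford m s"
  using neumann_clifford_partial_sum[OF assms(1-3), of m] assms(4) by linarith

lemma neumann_clifford_neg:
  assumes "0 \<le> s" "0 < N" "4 * s \<le> (real (N + 1))\<^sup>2"
    and "(\<Sum>n<N. neumann_term m s n) < - 2 * \<bar>neumann_term m s N\<bar>"
  shows "neumann_clifford m s < 0"
  using neumann_clifford_partial_sum[OF assms(1-3), of m] assms(4) by linarith

lemma neumann_clifford_positive_at_0: "0 < m \<Longrightarrow> 0 < neumann_clifford m 0"
  by (simp add: neumann_clifford_def bessel_clifford_0)

subsection \<open>Eigenfunctions of the disk\<close>

text \<open>Harmonicity of \<open>P\<close> leaves the cross term and the radial part of the
  Laplacian, and \<open>bessel_clifford_recurrence\<close> combines them into the eigenvalue
  equation. Euler's identity turns the radial derivative into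
  \<open>P x * neumann_clifford m (s * (x \<bullet> x))\<close>, which vanishes on the unit circle
  by the choice of \<open>s\<close>.\<close>

lemma bessel_mode_in_neumann_eigenspace:
  fixes P :: "'a::euclidean_space \<Rightarrow> real"
  assumes dim: "DIM('a) = 2"
    and P: "\<And>x. GDERIV P x :> Q x"
    and Q: "\<And>x i. i \<in> Basis \<Longrightarrow> GDERIV (\<lambda>y. Q y \<bullet> i) x :> R i x"
    and R: "\<And>i. i \<in> Basis \<Longrightarrow> continuous_on UNIV (R i)"
    and harmonic: "\<And>x. (\<Sum>i\<in>Basis. R i x \<bullet> i) = 0"
    and homogeneous: "\<And>x. x \<bullet> Q x = real m * P x"
    and s: "neumann_clifford m s = 0"
  shows "(\<lambda>x. P x * bessel_clifford m (s * (x \<bullet> x))) \<in> neumann_eigenspace (ball 0 1) (4 * s)"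
proof -
  define F where "F k x = bessel_clifford k (s * (x \<bullet> x))" for k and x :: 'a
  have F: "GDERIV (F k) x :> (- 2 * s * F (Suc k) x) *\<^sub>R x" for k x
  proof -
    have "((\<lambda>x. s * (x \<bullet> x)) has_derivative (\<lambda>h. h \<bullet> ((2 * s) *\<^sub>R x))) (at x)"
      by (auto intro!: derivative_eq_intros simp: inner_commute algebra_simps)
    from GDERIV_DERIV_compose[OF this[folded gderiv_def] DERIV_bessel_clifford]
    show ?thesis unfolding F_def by (simp add: mult_ac)
  qed
  have cF: "continuous_on S (F k)" for k S by (rule GDERIV_continuous_on[OF F])
  have cP: "continuous_on S P" for S by (rule GDERIV_continuous_on[OF P])
  have cQi: "continuous_on S (\<lambda>x. Q x \<bullet> i)" if "i \<in> Basis" for S i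
    by (rule GDERIV_continuous_on[OF Q[OF that]])
  have cQ: "continuous_on S Q" for S using cQi by (subst continuous_on_componentwise) auto
  define g where "g x = P x *\<^sub>R ((- 2 * s * F (Suc m) x) *\<^sub>R x) + F m x *\<^sub>R Q x" for x
  \<comment> \<open>The gradient is \<open>a x *\<^sub>R x + F m x *\<^sub>R Q x\<close>. Here
    \<open>a'\<close> is the gradient of \<open>a\<close>, and \<open>R' i\<close> is the gradient
    of the \<open>i\<close>-th component, by the product rule.\<close>
  define a where "a x = P x * (- 2 * s * F (Suc m) x)" for x
  define a' where "a' x = P x *\<^sub>R ((- 2 * s) *\<^sub>R ((- 2 * s * F (Suc (Suc m)) x) *\<^sub>R x)) + (- 2 * s * F (Suc m) x) *\<^sub>R Q x" for x
  have a: "GDERIV a x :> a' x" for x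
  proof -
    have "GDERIV (\<lambda>x. - 2 * s * F (Suc m) x) x :> (- 2 * s) *\<^sub>R ((- 2 * s * F (Suc (Suc m)) x) *\<^sub>R x)"
      using GDERIV_mult[OF GDERIV_const F, of "- 2 * s" "Suc m" x] by simp
    from GDERIV_mult[OF P this] show ?thesis unfolding a_def a'_def .
  qed
  define R' where "R' i x = (a x *\<^sub>R i + (x \<bullet> i) *\<^sub>R a' x) +
    (F m x *\<^sub>R R i x + (Q x \<bullet> i) *\<^sub>R ((- 2 * s * F (Suc m) x) *\<^sub>R x))" for i x
  obtain B where B: "\<forall>q\<in>{0..1}. \<bar>neumann_clifford m (s * q)\<bar> \<le> B * (1 - q)"
    using neumann_clifford_lipschitz_at_zero[OF s] by blast
  obtain B' where B': "\<forall>x\<in>ball 0 1. norm (P x) \<le> B'"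
    using bounded_continuous_image[OF cP, of "ball 0 1"] bounded_ball by blast
  show ?thesis
  proof (rule neumann_eigenspace_ballI)
    show "GDERIV (\<lambda>x. P x * bessel_clifford m (s * (x \<bullet> x))) x :> g x" for x
      using GDERIV_mult[OF P F] unfolding F_def[symmetric] g_def .
    show "GDERIV (\<lambda>y. g y \<bullet> i) x :> R' i x" if i: "i \<in> Basis" for i x
    proof -
      have "GDERIV (\<lambda>y. y \<bullet> i) x :> i"
        unfolding gderiv_def by (intro bounded_linear_imp_has_derivative bounded_linear_inner_left)
      from GDERIV_add[OF GDERIV_mult[OF a this] GDERIV_mult[OF F[of m] Q[OF i]]]
      have "GDERIV (\<lambda>x. a x * (x \<bullet> i) + F m x * (Q x \<bullet> i)) x :> R' i x"
        unfolding R'_def .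
      moreover have "(\<lambda>y. g y \<bullet> i) = (\<lambda>x. a x * (x \<bullet> i) + F m x * (Q x \<bullet> i))"
        by (auto simp: g_def a_def inner_add_left inner_diff_left)
      ultimately show ?thesis by (simp only:)
    qed
    show "continuous_on UNIV (R' i)" if "i \<in> Basis" for i
      unfolding R'_def a_def a'_def by (intro continuous_intros cF cP cQ cQi R that)
    show "(\<Sum>i\<in>Basis. R' i x \<bullet> i) = - (4 * s) * (P x * bessel_clifford m (s * (x \<bullet> x)))" for x
    proof -
      have "(\<Sum>i\<in>Basis. R' i x \<bullet> i) = (\<Sum>i\<in>(Basis::'a set). a x * (i \<bullet> i)) + (\<Sum>i\<in>Basis. (a' x \<bullet> i) * (x \<bullet> i))
          + F m x * (\<Sum>i\<in>Basis. R i x \<bullet> i) + (- 2 * s * F (Suc m) x) * (\<Sum>i\<in>Basis. (x \<bullet> i) * (Q x \<bullet> i))"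
        by (simp add: R'_def inner_add_left inner_diff_left sum.distrib sum_subtractf sum_distrib_left sum_negf mult_ac)
      \<comment> \<open>The dimension enters here: \<open>a x\<close> gets the coefficient 2 from
        this trace and 2 m from the two uses of \<open>homogeneous\<close>, which matches the factor
        \<open>real (Suc m)\<close> of the recurrence.\<close>
      also have "(\<Sum>i\<in>(Basis::'a set). a x * (i \<bullet> i)) = 2 * a x"
        by (simp add: dim)
      also have "(\<Sum>i\<in>Basis. (a' x \<bullet> i) * (x \<bullet> i)) = a' x \<bullet> x"
        by (rule euclidean_inner[symmetric])
      also have "(\<Sum>i\<in>Basis. (x \<bullet> i) * (Q x \<bullet> i)) = real m * P x"
        unfolding homogeneous[symmetric] by (rule euclidean_inner[symmetric])
      also have "a' x \<bullet> x = 4 * s\<^sup>2 * P x * F (Suc (Suc m)) x * (x \<bullet> x) - 2 * s * F (Suc m) x * (real m * P x)"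
        unfolding homogeneous[symmetric]
        by (simp add: a'_def inner_add_left inner_diff_left inner_commute[of "Q x"] power2_eq_square)
      also have "2 * a x + (4 * s\<^sup>2 * P x * F (Suc (Suc m)) x * (x \<bullet> x) - 2 * s * F (Suc m) x * (real m * P x))
          + F m x * (\<Sum>i\<in>Basis. R i x \<bullet> i) + - 2 * s * F (Suc m) x * (real m * P x)
         = 4 * s * P x * (s * (x \<bullet> x) * F (Suc (Suc m)) x - real (Suc m) * F (Suc m) x)"
        by (simp add: harmonic a_def power2_eq_square algebra_simps)
      also have "s * (x \<bullet> x) * F (Suc (Suc m)) x - real (Suc m) * F (Suc m) x = - F m x"
        using bessel_clifford_recurrence[of "s * (x \<bullet> x)" m] unfolding F_def by linarith
      finally show ?thesis by (simp add: F_def)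
    qed
    show "\<bar>x \<bullet> g x\<bar> \<le> (B' * B) * (1 - x \<bullet> x)" if x: "x \<in> ball 0 1" for x
    proof -
      have "x \<bullet> g x = P x * (- 2 * s * F (Suc m) x * (x \<bullet> x)) + F m x * (real m * P x)"
        unfolding homogeneous[symmetric] by (simp add: g_def inner_add_right inner_diff_right)
      also have "\<dots> = P x * neumann_clifford m (s * (x \<bullet> x))"
        by (simp add: neumann_clifford_def F_def algebra_simps)
      finally have "\<bar>x \<bullet> g x\<bar> = \<bar>P x\<bar> * \<bar>neumann_clifford m (s * (x \<bullet> x))\<bar>"
        by (simp add: abs_mult)
      also have "\<dots> \<le> B' * (B * (1 - x \<bullet> x))"
      proof (rule mult_mono)
        show "\<bar>P x\<bar> \<le> B'" using B' x by simp
        then show "0 \<le> B'" by linarith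
        have "x \<bullet> x < 1" using x by (simp add: norm_lt_square)
        then show "\<bar>neumann_clifford m (s * (x \<bullet> x))\<bar> \<le> B * (1 - x \<bullet> x)" using B by simp
      qed simp
      finally show ?thesis by simp
    qed
  qed
qed

section \<open>Homogeneous harmonic polynomials in the plane\<close>

definition to_complex :: "real ^ 2 \<Rightarrow> complex" where
  "to_complex x = Complex (x $ 1) (x $ 2)"

definition harmonic_poly :: "complex \<Rightarrow> nat \<Rightarrow> real ^ 2 \<Rightarrow> real" where
  "harmonic_poly c m x = Re (c * to_complex x ^ m)"

text \<open>By the Cauchy-Riemann equations the gradient of the real part of a holomorphic function
  is the conjugate of its derivative, here of \<open>w\<close>. For \<open>m = 0\<close> the factor
  \<open>of_nat m\<close> is 0, so the truncated exponent \<open>m - 1\<close> does no harm.\<close>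

definition harmonic_poly_gradient :: "complex \<Rightarrow> nat \<Rightarrow> real ^ 2 \<Rightarrow> real ^ 2" where
  "harmonic_poly_gradient c m x =
     (let w = of_nat m * c * to_complex x ^ (m - 1) in \<chi> i. if i = 1 then Re w else - Im w)"

lemma bounded_linear_to_complex: "bounded_linear to_complex"
  by (rule linear_conv_bounded_linear[THEN iffD1], rule linearI)
    (auto simp: to_complex_def complex_eq_iff)

lemma inner_harmonic_poly_gradient:
  "h \<bullet> harmonic_poly_gradient c m x = Re (of_nat m * c * to_complex x ^ (m - 1) * to_complex h)"
proof -
  define w where "w = of_nat m * c * to_complex x ^ (m - 1)"
  have "harmonic_poly_gradient c m x = (\<chi> i. if i = 1 then Re w else - Im w)"
    by (simp only: harmonic_poly_gradient_def w_def Let_def)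
  then have "h \<bullet> harmonic_poly_gradient c m x = Re (w * to_complex h)"
    by (simp add: inner_vec_def sum_2 to_complex_def mult.commute)
  then show ?thesis by (simp only: w_def)
qed

lemma GDERIV_harmonic_poly: "GDERIV (harmonic_poly c m) x :> harmonic_poly_gradient c m x"
proof -
  have z: "(to_complex has_derivative to_complex) (at x)"
    by (rule bounded_linear_imp_has_derivative[OF bounded_linear_to_complex])
  have "((\<lambda>y. c * to_complex y ^ m) has_derivative
      (\<lambda>h. c * (of_nat m * to_complex h * to_complex x ^ (m - 1)))) (at x)"
    by (intro has_derivative_mult_right has_derivative_power z)
  from has_derivative_Re[OF this]
  show ?thesis
    unfolding gderiv_def harmonic_poly_def[abs_def] inner_harmonic_poly_gradient
    by (simp add: mult_ac)
qed

text \<open>The component in direction \<open>i\<close> is again a \<open>harmonic_poly\<close>, of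
  degree \<open>m - 1\<close>, so the formula for first derivatives also yields the second
  ones.\<close>

lemma GDERIV_harmonic_poly_gradient:
  "GDERIV (\<lambda>y. harmonic_poly_gradient c m y \<bullet> i) x :>
     harmonic_poly_gradient (of_nat m * c * to_complex i) (m - 1) x"
proof -
  have "(\<lambda>y. harmonic_poly_gradient c m y \<bullet> i) = harmonic_poly (of_nat m * c * to_complex i) (m - 1)"
    by (auto simp: inner_commute[of _ i] inner_harmonic_poly_gradient harmonic_poly_def mult_ac)
  then show ?thesis using GDERIV_harmonic_poly by simp
qed

lemma sum_Basis_real2: "(\<Sum>i\<in>(Basis :: (real ^ 2) set). f i) = f (axis 1 1) + f (axis 2 1)"
proof -
  have B: "(Basis :: (real ^ 2) set) = {axis 1 1, axis 2 1}"
    by (auto simp: Basis_vec_def UNIV_2)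
  have "axis 1 1 \<notin> {axis 2 1 :: real ^ 2}"
    by (simp add: axis_eq_axis)
  then show ?thesis unfolding B by (subst sum.insert) auto
qed

text \<open>The basis vectors correspond to 1 and \<i>, whose squares cancel in the sum of the
  second derivatives.\<close>

lemma harmonic_poly_harmonic:
  "(\<Sum>i\<in>Basis. harmonic_poly_gradient (of_nat m * c * to_complex i) (m - 1) x \<bullet> i) = 0"
proof -
  have "to_complex (axis 1 1) = 1" "to_complex (axis 2 1) = \<i>"
    by (simp_all add: to_complex_def axis_def complex_eq_iff)
  then show ?thesis
    unfolding sum_Basis_real2 inner_commute[of _ "axis _ _"] inner_harmonic_poly_gradient
    by simp
qed

lemma harmonic_poly_homogeneous: "x \<bullet> harmonic_poly_gradient c m x = real m * harmonic_poly c m x"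
proof (cases m)
  case (Suc k)
  have "of_nat m * c * to_complex x ^ (m - 1) * to_complex x = of_real (real m) * (c * to_complex x ^ m)"
    by (simp add: Suc)
  moreover have "Re (of_real r * w) = r * Re w" for r w by simp
  ultimately show ?thesis unfolding inner_harmonic_poly_gradient harmonic_poly_def by (simp only:)
qed (simp add: inner_harmonic_poly_gradient)

lemma continuous_on_harmonic_poly_gradient: "continuous_on UNIV (harmonic_poly_gradient c m)"
  by (subst continuous_on_componentwise)
    (auto intro: GDERIV_continuous_on[OF GDERIV_harmonic_poly_gradient])

text \<open>The flag selects the real part of z^m or, through multiplication by \<i>, minus its
  imaginary part. For \<open>m = 0\<close> the mode with flag \<open>True\<close> is identically 0
  and has to be left out.\<close>

definition disk_mode :: "real \<Rightarrow> nat \<times> bool \<Rightarrow> real ^ 2 \<Rightarrow> real" where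
  "disk_mode s = (\<lambda>(m, b) x. harmonic_poly (if b then \<i> else 1) m x * bessel_clifford m (s * (x \<bullet> x)))"

lemma disk_mode_in_neumann_eigenspace:
  assumes "neumann_clifford m s = 0"
  shows "disk_mode s (m, b) \<in> neumann_eigenspace (ball 0 1) (4 * s)"
  unfolding disk_mode_def prod.case
  by (rule bessel_mode_in_neumann_eigenspace[OF _ GDERIV_harmonic_poly GDERIV_harmonic_poly_gradient
        continuous_on_harmonic_poly_gradient harmonic_poly_harmonic harmonic_poly_homogeneous assms]) simp

lemma continuous_on_disk_mode: "continuous_on S (disk_mode s e)"
proof -
  have "continuous_on S (harmonic_poly c m)" for c m
    by (rule GDERIV_continuous_on[OF GDERIV_harmonic_poly])
  then show ?thesis
    unfolding disk_mode_def case_prod_beta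
    by (intro continuous_intros continuous_on_compose2[OF continuous_on_bessel_clifford]) auto
qed

text \<open>Degrees are separated by the order of vanishing at the origin, and the two modes of the
  lowest degree that occurs by their values on the unit circle.\<close>

lemma disk_modes_independent:
  assumes A: "finite A" "\<And>m. (m, True) \<in> A \<Longrightarrow> 0 < m"
    and zero: "\<And>x. x \<in> ball 0 1 \<Longrightarrow> (\<Sum>e\<in>A. k e * disk_mode s e x) = 0"
    and e: "e \<in> A"
  shows "k e = 0"
proof (rule ccontr)
  assume "k e \<noteq> 0"
  define m0 where "m0 = (LEAST m. \<exists>b. (m, b) \<in> A \<and> k (m, b) \<noteq> 0)"
  have ex: "\<exists>b. (fst e, b) \<in> A \<and> k (fst e, b) \<noteq> 0" using e \<open>k e \<noteq> 0\<close> by (cases e) auto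
  have m0: "\<exists>b. (m0, b) \<in> A \<and> k (m0, b) \<noteq> 0"
    unfolding m0_def by (rule LeastI[of _ "fst e"]) (rule ex)
  have below: "k (m, b) = 0" if "(m, b) \<in> A" "m < m0" for m b
    using not_less_Least[of m] that unfolding m0_def by blast
  define c where "c b = (if b then \<i> else 1)" for b
  \<comment> \<open>Divide by \<open>r ^ m0\<close> along the ray through \<open>w\<close> and let \<open>r\<close> tend to \<open>0\<close>.\<close>
  have main: "(\<Sum>b\<in>{b. (m0, b) \<in> A}. k (m0, b) * Re (c b * w ^ m0)) = 0" if w: "norm w = 1" for w
  proof -
    \<comment> \<open>For degrees below \<open>m0\<close> the exponent truncates to 0, but their
      coefficients vanish by \<open>below\<close>.\<close>
    define h where "h r = (\<Sum>e\<in>A. k e * (r ^ (fst e - m0) * Re (c (snd e) * w ^ fst e) * bessel_clifford (fst e) (s * r\<^sup>2)))" for r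
    have h0: "h r = 0" if r: "r \<in> {0<..<1}" for r
    proof -
      define x :: "real ^ 2" where "x = (\<chi> i. if i = 1 then r * Re w else r * Im w)"
      have z: "to_complex x = of_real r * w"
        by (simp add: to_complex_def x_def complex_eq_iff)
      have "(Re w)\<^sup>2 + (Im w)\<^sup>2 = 1" using w by (simp add: cmod_def)
      moreover have "x \<bullet> x = r\<^sup>2 * ((Re w)\<^sup>2 + (Im w)\<^sup>2)"
        by (simp add: inner_vec_def sum_2 x_def power2_eq_square algebra_simps)
      ultimately have xx: "x \<bullet> x = r\<^sup>2" by simp
      then have "norm x = r" using r by (simp add: norm_eq_sqrt_inner)
      then have "x \<in> ball 0 1" using r by simp
      then have "(\<Sum>e\<in>A. k e * disk_mode s e x) = 0" by (rule zero)
      moreover have "k e * disk_mode s e x =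
          r ^ m0 * (k e * (r ^ (fst e - m0) * Re (c (snd e) * w ^ fst e) * bessel_clifford (fst e) (s * r\<^sup>2)))"
        if e: "e \<in> A" for e
      proof (cases "fst e < m0")
        case True
        then show ?thesis using below[of "fst e" "snd e"] e by simp
      next
        case False
        have "c (snd e) * to_complex x ^ fst e = of_real (r ^ fst e) * (c (snd e) * w ^ fst e)"
          unfolding z by (simp add: power_mult_distrib)
        moreover have "Re (of_real a * w) = a * Re w" for a w by simp
        ultimately have "harmonic_poly (c (snd e)) (fst e) x = r ^ fst e * Re (c (snd e) * w ^ fst e)"
          unfolding harmonic_poly_def by (simp only:)
        moreover have "r ^ fst e = r ^ m0 * r ^ (fst e - m0)"
          using False by (simp flip: power_add)
        ultimately show ?thesis by (simp add: disk_mode_def case_prod_beta xx c_def)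
      qed
      ultimately have "r ^ m0 * h r = 0" unfolding h_def sum_distrib_left by simp
      then show ?thesis using r by simp
    qed
    have "continuous_on UNIV h"
      unfolding h_def by (intro continuous_intros continuous_on_compose2[OF continuous_on_bessel_clifford]) auto
    then have "(h \<longlongrightarrow> h 0) (at_right 0)"
      by (metis UNIV_I continuous_on_def filterlim_at_split iso_tuple_UNIV_I)
    moreover have "(h \<longlongrightarrow> 0) (at_right 0)"
    proof (rule tendsto_eventually)
      show "eventually (\<lambda>r. h r = 0) (at_right 0)"
        by (rule eventually_mono[OF eventually_at_right_real[OF zero_less_one]]) (rule h0)
    qed
    ultimately have "h 0 = 0" by (rule tendsto_unique[OF trivial_limit_at_right_real])
    \<comment> \<open>At 0 the higher degrees drop out through a positive power of 0, and
      \<open>bessel_clifford m0\<close> contributes its value \<open>1 / fact m0\<close>.\<close>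
    moreover have "h 0 = (\<Sum>e\<in>{e\<in>A. fst e = m0}. k e * Re (c (snd e) * w ^ m0) / fact m0)"
      unfolding h_def
    proof (rule sum.mono_neutral_cong_right[OF A(1)])
      show "\<forall>e\<in>A - {e \<in> A. fst e = m0}. k e * (0 ^ (fst e - m0) * Re (c (snd e) * w ^ fst e) * bessel_clifford (fst e) (s * 0\<^sup>2)) = 0"
      proof
        fix e assume e: "e \<in> A - {e \<in> A. fst e = m0}"
        then consider "fst e < m0" | "0 < fst e - m0" by (auto simp: neq_iff)
        then show "k e * (0 ^ (fst e - m0) * Re (c (snd e) * w ^ fst e) * bessel_clifford (fst e) (s * 0\<^sup>2)) = 0"
          by cases (use below[of "fst e" "snd e"] e in auto)
      qed
    qed (auto simp: bessel_clifford_0)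
    also have "\<dots> = (\<Sum>b\<in>{b. (m0, b) \<in> A}. k (m0, b) * Re (c b * w ^ m0) / fact m0)"
      by (rule sum.reindex_bij_witness[where i = "\<lambda>b. (m0, b)" and j = snd]) auto
    finally show ?thesis by (simp flip: sum_divide_distrib)
  qed
  define k' where "k' b = (if (m0, b) \<in> A then k (m0, b) else 0)" for b
  have main': "k' False * Re (w ^ m0) + k' True * Re (\<i> * w ^ m0) = 0" if "norm w = 1" for w
  proof -
    have "(\<Sum>b\<in>{b. (m0, b) \<in> A}. k (m0, b) * Re (c b * w ^ m0)) = (\<Sum>b\<in>UNIV. k' b * Re (c b * w ^ m0))"
      by (rule sum.mono_neutral_cong_left) (auto simp: k'_def)
    then show ?thesis using main[OF that] by (simp add: UNIV_bool c_def)
  qed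
  \<comment> \<open>At \<open>w = 1\<close> the second summand is the real part of \<i>, which is
    0.\<close>
  have "k' False = 0" using main'[of 1] by simp
  moreover have "k' True = 0"
  proof (cases "m0 = 0")
    case True
    then show ?thesis using A(2)[of 0] by (auto simp: k'_def)
  next
    case False
    \<comment> \<open>This angle makes \<open>w ^ m0\<close> equal to \<i>, so the first summand of
      \<open>main'\<close> is 0 and the second is \<open>- k' True\<close>.\<close>
    have "real m0 * (pi / (2 * real m0)) = pi / 2" using False by simp
    then have "cis (pi / (2 * real m0)) ^ m0 = \<i>" by (simp only: Complex.DeMoivre cis_pi_half)
    then show ?thesis using main'[of "cis (pi / (2 * real m0))"] by simp
  qed
  ultimately show False using m0 by (metis (full_types) k'_def)
qed

text \<open>The set where \<open>f\<close> is nonzero is open and Lebesgue-null, hence empty. This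
  turns the almost-everywhere relations in \<open>ae_independent\<close> into pointwise
  ones.\<close>

lemma continuous_AE_zero:
  fixes f :: "'a::euclidean_space \<Rightarrow> real"
  assumes f: "continuous_on S f" and S: "open S" and 0: "AE x in lebesgue_on S. f x = 0" and x: "x \<in> S"
  shows "f x = 0"
proof -
  let ?U = "{x \<in> S. f x \<noteq> 0}"
  have "?U = f -` (- {0}) \<inter> S" by auto
  then have "open ?U" using f S by (metis continuous_on_open_vimage open_Compl closed_singleton)
  have "AE x in lebesgue. x \<in> S \<longrightarrow> f x = 0"
    using 0 S by (subst (asm) AE_restrict_space_iff) auto
  then have "?U \<in> null_sets lebesgue"
    using \<open>open ?U\<close> by (subst AE_iff_null_sets) (auto elim: eventually_mono)
  then have "negligible ?U" by (simp add: negligible_iff_null_sets)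
  then have "?U = {}" using open_not_negligible[OF \<open>open ?U\<close>] by blast
  then show ?thesis using x by blast
qed

text \<open>Zeros of \<open>neumann_clifford m\<close> for different \<open>m\<close> are allowed to
  coincide, so \<open>A\<close> collects modes of possibly different degrees that share the same
  \<open>s\<close>.\<close>

lemma neumann_multiplicity_disk_ge:
  assumes A: "finite A" "\<And>m. (m, True) \<in> A \<Longrightarrow> 0 < m"
    and s: "\<And>m b. (m, b) \<in> A \<Longrightarrow> neumann_clifford m s = 0"
  shows "enat (card A) \<le> neumann_multiplicity (ball (0 :: real ^ 2) 1) (4 * s)"
proof -
  obtain h where h: "bij_betw h {0..<card A} A" using ex_bij_betw_nat_finite[OF A(1)] by blast
  define u where "u i = disk_mode s (h i)" for i
  have "u i \<in> neumann_eigenspace (ball 0 1) (4 * s)" if "i < card A" for i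
  proof -
    have "h i \<in> A" using h that by (auto simp: bij_betw_def)
    then show ?thesis
      unfolding u_def using s disk_mode_in_neumann_eigenspace by (cases "h i") auto
  qed
  moreover have "ae_independent (ball 0 1) (card A) u"
    unfolding ae_independent_def
  proof (intro allI impI)
    fix c :: "nat \<Rightarrow> real" and i
    assume 0: "AE x in lebesgue_on (ball 0 1). (\<Sum>i<card A. c i * u i x) = 0" and i: "i < card A"
    have sum0: "(\<Sum>i<card A. c i * u i x) = 0" if "x \<in> ball 0 1" for x
      by (rule continuous_AE_zero[OF _ open_ball 0 that])
        (unfold u_def, intro continuous_intros continuous_on_disk_mode)
    define k where "k e = c (the_inv_into {0..<card A} h e)" for e
    have k: "k (h i) = c i" if "i < card A" for i
      using h that by (simp add: k_def bij_betw_def the_inv_into_f_f)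
    have "(\<Sum>e\<in>A. k e * disk_mode s e x) = 0" if "x \<in> ball 0 1" for x
    proof -
      have "(\<Sum>e\<in>A. k e * disk_mode s e x) = (\<Sum>i\<in>{0..<card A}. k (h i) * disk_mode s (h i) x)"
        by (rule sum.reindex_bij_betw[OF h, symmetric])
      also have "\<dots> = (\<Sum>i<card A. c i * u i x)"
        by (rule sum.cong) (auto simp: k u_def)
      finally show ?thesis using sum0[OF that] by simp
    qed
    moreover have "h i \<in> A" using h i by (auto simp: bij_betw_def)
    ultimately have "k (h i) = 0"
      using disk_modes_independent[OF A, of k s "h i"] by blast
    then show "c i = 0" using k[OF i] by simp
  qed
  ultimately show ?thesis
    unfolding neumann_multiplicity_def by (intro Sup_upper) blast
qed

section \<open>Lower bounds for the spectrum and the counting function\<close>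

lemma ecard_mono: "A \<subseteq> B \<Longrightarrow> ecard A \<le> ecard B"
  by (auto simp: ecard_def card_mono dest: finite_subset)

text \<open>Grouping the modes by \<open>s\<close> gives one multiplicity bound for each eigenvalue
  \<open>4 * s\<close>, and the sizes of the groups add up to \<open>card Z\<close>.\<close>

lemma neumann_spectrum_upto_disk_ge:
  assumes Z: "finite Z"
    and Z': "\<And>s m b. (s, m, b) \<in> Z \<Longrightarrow> neumann_clifford m s = 0 \<and> (b \<longrightarrow> 0 < m) \<and> 4 * s \<le> t"
  shows "enat (card Z) \<le> ecard (neumann_spectrum_upto (ball (0 :: real ^ 2) 1) t)"
proof -
  define A where "A s = {e. (s, e) \<in> Z}" for s
  have fA: "finite (A s)" for s
    unfolding A_def by (rule finite_subset[OF _ finite_imageI[OF Z, of snd]]) force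
  have A: "enat (card (A s)) \<le> neumann_multiplicity (ball (0 :: real ^ 2) 1) (4 * s)" for s
    by (rule neumann_multiplicity_disk_ge[OF fA]) (use Z' in \<open>auto simp: A_def\<close>)
  \<comment> \<open>One index per mode in the group of \<open>s\<close>; scaling the first component
    by 4 is injective and maps these pairs into the spectrum.\<close>
  let ?W = "SIGMA s:fst ` Z. {..<card (A s)}"
  have "Z = (SIGMA s:fst ` Z. A s)" by (force simp: A_def)
  then have "card Z = (\<Sum>s\<in>fst ` Z. card (A s))"
    using Z fA by (metis card_SigmaI finite_imageI)
  also have "\<dots> = card ?W" using Z by simp
  also have "\<dots> = card ((\<lambda>(s, k). (4 * s, k)) ` ?W)"
    by (rule card_image[symmetric]) (auto simp: inj_on_def)
  finally have "enat (card Z) = ecard ((\<lambda>(s, k). (4 * s, k)) ` ?W)"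
    using Z by (simp add: ecard_def)
  also have "\<dots> \<le> ecard (neumann_spectrum_upto (ball (0 :: real ^ 2) 1) t)"
  proof (rule ecard_mono, safe)
    fix s k e assume "e \<in> Z" "k < card (A (fst e))"
    then have "4 * fst e \<le> t" using Z'[of "fst e" "fst (snd e)" "snd (snd e)"] by simp
    moreover have "enat k < neumann_multiplicity (ball (0 :: real ^ 2) 1) (4 * fst e)"
      using A[of "fst e"] \<open>k < card (A (fst e))\<close> by (meson enat_ord_simps(2) less_le_trans)
    ultimately show "(4 * fst e, k) \<in> neumann_spectrum_upto (ball (0 :: real ^ 2) 1) t"
      by (simp add: neumann_spectrum_upto_def)
  qed
  finally show ?thesis .
qed

text \<open>For every index up to \<open>N\<close>, \<open>lam\<^sup>2\<close> is one of the values
  over which the infimum in \<open>neumann_eigenvalue\<close> is taken.\<close>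

lemma neumann_counting_ge:
  assumes "enat N \<le> ecard (neumann_spectrum_upto \<Omega> (lam\<^sup>2))"
  shows "enat N \<le> neumann_counting \<Omega> lam"
proof -
  have "{1..N} \<subseteq> {n. 1 \<le> n \<and> neumann_eigenvalue \<Omega> n \<le> ereal (lam\<^sup>2)}"
  proof safe
    fix n assume "n \<in> {1..N}"
    then have "enat n \<le> ecard (neumann_spectrum_upto \<Omega> (lam\<^sup>2))"
      using assms by (meson atLeastAtMost_iff enat_ord_simps(1) order_trans)
    then show "neumann_eigenvalue \<Omega> n \<le> ereal (lam\<^sup>2)"
      unfolding neumann_eigenvalue_def by (intro Inf_lower) blast
  qed simp
  from ecard_mono[OF this] show ?thesis
    by (simp add: neumann_counting_def ecard_def)
qed

subsection \<open>Location of the eigenvalues\<close>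

text \<open>Exact rational evaluation of 24 terms and of the error bound. \<open>N = 24\<close> is
  admissible because \<open>4 * s\<close> is at most 192, below \<open>25\<^sup>2\<close>. Together
  with the negative values below, these points bracket the zeros.\<close>

lemma neumann_clifford_positive_values:
  "0 < neumann_clifford 0 5"
  "0 < neumann_clifford 0 31"
  "0 < neumann_clifford 1 10"
  "0 < neumann_clifford 1 38"
  "0 < neumann_clifford 2 14"
  "0 < neumann_clifford 3 19"
  "0 < neumann_clifford 4 25"
  "0 < neumann_clifford 5 32"
  "0 < neumann_clifford 6 40"
  "0 < neumann_clifford 7 48"
  by (rule neumann_clifford_pos[where N = 24]; simp add: neumann_term_def lessThan_nat_numeral lessThan_Suc fact_numeral)+

lemma neumann_clifford_negative_values:
  "neumann_clifford 0 1 < 0"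
  "neumann_clifford 0 16 < 0"
  "neumann_clifford 1 2 < 0"
  "neumann_clifford 1 21 < 0"
  "neumann_clifford 2 3 < 0"
  "neumann_clifford 2 29 < 0"
  "neumann_clifford 3 6 < 0"
  "neumann_clifford 3 36 < 0"
  "neumann_clifford 4 8 < 0"
  "neumann_clifford 4 44 < 0"
  "neumann_clifford 5 12 < 0"
  "neumann_clifford 6 17 < 0"
  "neumann_clifford 7 23 < 0"
  "neumann_clifford 8 27 < 0"
  "neumann_clifford 9 34 < 0"
  "neumann_clifford 10 42 < 0"
  "neumann_clifford 11 46 < 0"
  by (rule neumann_clifford_neg[where N = 24]; simp add: neumann_term_def lessThan_nat_numeral lessThan_Suc fact_numeral)+

text \<open>An entry \<open>(m, a, b)\<close> stands for a zero of \<open>neumann_clifford m\<close> in \<open>(a, b]\<close>; the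
  constant mode has \<open>m = 0\<close> and the zero \<open>0\<close>.\<close>

definition brackets :: "(nat \<times> int \<times> int) list" where
  "brackets =
    [(0, -1, 0), (0, 1, 5), (0, 5, 16), (0, 16, 31),
     (1, 0, 2), (1, 2, 10), (1, 10, 21), (1, 21, 38),
     (2, 0, 3), (2, 3, 14), (2, 14, 29),
     (3, 0, 6), (3, 6, 19), (3, 19, 36),
     (4, 0, 8), (4, 8, 25), (4, 25, 44),
     (5, 0, 12), (5, 12, 32),
     (6, 0, 17), (6, 17, 40),
     (7, 0, 23), (7, 23, 48),
     (8, 0, 27),
     (9, 0, 34),
     (10, 0, 42),
     (11, 0, 46)]"

text \<open>A zero for \<open>m > 0\<close> carries two modes and a zero for \<open>m = 0\<close>
  only one, which gives 50 modes in all.\<close>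

definition modes :: "((nat \<times> int \<times> int) \<times> bool) list" where
  "modes = concat (map (\<lambda>e. if fst e = 0 then [(e, False)] else [(e, False), (e, True)]) brackets)"

text \<open>The brackets are half-open on the left, so even those that share an endpoint contain
  different zeros.\<close>

lemma brackets_disjoint:
  assumes "(m, a, b) \<in> set brackets" "(m, a', b') \<in> set brackets" "(a, b) \<noteq> (a', b')"
  shows "b \<le> a' \<or> b' \<le> a"
proof -
  have "\<forall>(m, a, b)\<in>set brackets. \<forall>(m', a', b')\<in>set brackets.
      m = m' \<longrightarrow> a = a' \<and> b = b' \<or> b \<le> a' \<or> b' \<le> a"
    by (simp add: brackets_def)
  then show ?thesis using assms by fastforce
qed

lemma distinct_modes: "distinct modes"
  by (simp add: modes_def brackets_def)

text \<open>A zero is at most the upper endpoint \<open>b\<close> of its bracket, so the modes with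
  \<open>b \<le> int j\<close> have eigenvalues at most \<open>4 * j\<close>. Counting endpoints
  makes this a finite check on integers.\<close>

lemma modes_count:
  assumes "2 \<le> j" "j < 49"
  shows "j < length (filter (\<lambda>((m, a, b), c). b \<le> int j) modes)"
proof -
  have "\<forall>j\<in>set [2..<49]. j < length (filter (\<lambda>((m, a, b), c). b \<le> int j) modes)"
    by (simp add: modes_def brackets_def)
  then show ?thesis by (rule bspec) (use assms in \<open>simp only: set_upt atLeastLessThan_iff\<close>)
qed

lemma modes_iff: "(e, c) \<in> set modes \<longleftrightarrow> e \<in> set brackets \<and> (c \<longrightarrow> 0 < fst e)"
  by (cases c) (auto simp: modes_def)

lemma neumann_clifford_zero_between:
  assumes "a < b" "neumann_clifford m a * neumann_clifford m b < 0"
  shows "\<exists>z. a < z \<and> z \<le> b \<and> neumann_clifford m z = 0"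
proof -
  have "\<exists>z. a \<le> z \<and> z \<le> b \<and> neumann_clifford m z = 0"
    using assms IVT'[OF _ _ _ continuous_on_neumann_clifford, of m a 0 b]
      IVT2'[OF _ _ _ continuous_on_neumann_clifford, of m b 0 a]
    by (auto simp: mult_less_0_iff less_imp_le)
  \<comment> \<open>This excludes the left endpoint, as the half-open brackets require.\<close>
  moreover have "neumann_clifford m a \<noteq> 0" using assms by auto
  ultimately show ?thesis by (metis order_le_less)
qed

lemma brackets_zero:
  assumes "(m, a, b) \<in> set brackets"
  shows "\<exists>z. real_of_int a < z \<and> z \<le> real_of_int b \<and> neumann_clifford m z = 0"
proof (cases "(m, a, b) = (0, -1, 0)")
  \<comment> \<open>The constant mode: \<open>neumann_clifford 0 s\<close> has the factor
    \<open>s\<close>, so 0 itself is the zero, and the endpoint -1 places it inside the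
    bracket.\<close>
  case True
  then show ?thesis by (auto intro!: exI[of _ 0] simp: neumann_clifford_def)
next
  case False
  \<comment> \<open>Every other bracket shows a sign change; where its left endpoint is 0,
    \<open>m\<close> is positive and the value there is positive.\<close>
  have "\<forall>(m, a, b)\<in>set (tl brackets). a < b \<and> neumann_clifford m (real_of_int a) * neumann_clifford m (real_of_int b) < 0"
    by (simp add: brackets_def mult_pos_neg mult_neg_pos neumann_clifford_positive_at_0
        neumann_clifford_positive_values neumann_clifford_negative_values del: One_nat_def)
  moreover have "set brackets = insert (0, -1, 0) (set (tl brackets))"
    by (simp add: brackets_def)
  then have "(m, a, b) \<in> set (tl brackets)"
    using assms False by blast
  ultimately show ?thesis by (intro neumann_clifford_zero_between) auto
qed

theorem theorem1p5:
  fixes lam :: real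
  assumes "lam \<in> {3..14}"
  shows "ereal_of_enat (neumann_counting (ball (0 :: real ^ 2) 1) lam) \<ge> ereal (lam\<^sup>2 / 4)"
proof -
  \<comment> \<open>The ceiling minus 1, not the floor: when \<open>lam\<^sup>2 / 4\<close> is an
    integer, \<open>j\<close> lies one below it and \<open>j + 1\<close> eigenvalues are exactly
    enough.\<close>
  define j where "j = nat (\<lceil>lam\<^sup>2 / 4\<rceil> - 1)"
  have lo: "9 \<le> lam\<^sup>2" and hi: "lam\<^sup>2 \<le> 196"
    using assms power_mono[of 3 lam 2] power_mono[of lam 14 2] by auto
  have "2 < \<lceil>lam\<^sup>2 / 4\<rceil>" "\<lceil>lam\<^sup>2 / 4\<rceil> \<le> 49" using lo hi by linarith+
  then have ij: "int j = \<lceil>lam\<^sup>2 / 4\<rceil> - 1" and j: "2 \<le> j" "j < 49"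
    unfolding j_def by linarith+
  from ij have "real j = real_of_int \<lceil>lam\<^sup>2 / 4\<rceil> - 1" by linarith
  then have j': "real j < lam\<^sup>2 / 4" "lam\<^sup>2 / 4 \<le> real (Suc j)" by linarith+
  define z where "z = (\<lambda>(m, a, b). SOME z. real_of_int a < z \<and> z \<le> real_of_int b \<and> neumann_clifford m z = 0)"
  have z: "real_of_int a < z (m, a, b) \<and> z (m, a, b) \<le> real_of_int b \<and> neumann_clifford m (z (m, a, b)) = 0"
    if "(m, a, b) \<in> set brackets" for m a b
    using someI_ex[OF brackets_zero[OF that]] by (simp add: z_def)
  let ?L = "filter (\<lambda>((m, a, b), c). b \<le> int j) modes"
  \<comment> \<open>\<open>f\<close> records the zero, the order and the flag. It is injective
    because brackets of the same order are disjoint, so the number of list entries becomes a number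
    of modes.\<close>
  define f where "f = (\<lambda>(e :: nat \<times> int \<times> int, c :: bool). (z e, fst e, c))"
  have "inj_on f (set ?L)"
  proof (rule inj_onI)
    fix x y assume xy: "x \<in> set ?L" "y \<in> set ?L" "f x = f y"
    obtain m a b c where x: "x = ((m, a, b), c)" by (metis prod_cases4 surj_pair)
    obtain m' a' b' c' where y: "y = ((m', a', b'), c')" by (metis prod_cases4 surj_pair)
    have eq: "m' = m" "c' = c" "z (m, a, b) = z (m, a', b')" using xy(3) by (auto simp: f_def x y)
    have in_b: "(m, a, b) \<in> set brackets" "(m, a', b') \<in> set brackets"
      using xy(1,2) by (auto simp: x y eq modes_iff)
    have "(a, b) = (a', b')"
    proof (rule ccontr)
      assume "(a, b) \<noteq> (a', b')"
      then have "real_of_int b \<le> real_of_int a' \<or> real_of_int b' \<le> real_of_int a"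
        using brackets_disjoint[OF in_b] by simp
      then show False using z[OF in_b(1)] z[OF in_b(2)] eq(3) by linarith
    qed
    then show "x = y" by (simp add: x y eq)
  qed
  then have "card (f ` set ?L) = length ?L"
    using distinct_modes by (simp only: card_image distinct_card distinct_filter)
  moreover have "enat (card (f ` set ?L)) \<le> ecard (neumann_spectrum_upto (ball (0 :: real ^ 2) 1) (lam\<^sup>2))"
  proof (rule neumann_spectrum_upto_disk_ge)
    fix s m b assume "(s, m, b) \<in> f ` set ?L"
    then obtain a a' where a: "((m, a, a'), b) \<in> set modes" "a' \<le> int j" "s = z (m, a, a')"
      by (auto simp: f_def)
    then have "(m, a, a') \<in> set brackets" "b \<longrightarrow> 0 < m" by (auto simp: modes_iff)
    moreover have "real_of_int a' \<le> real j" using a(2) by linarith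
    ultimately show "neumann_clifford m s = 0 \<and> (b \<longrightarrow> 0 < m) \<and> 4 * s \<le> lam\<^sup>2"
      using z[of m a a'] a(3) j'(1) by auto
  qed simp
  ultimately have "enat (length ?L) \<le> neumann_counting (ball (0 :: real ^ 2) 1) lam"
    by (intro neumann_counting_ge) simp
  moreover have "Suc j \<le> length ?L" by (rule Suc_leI[OF modes_count[OF j]])
  ultimately have "enat (Suc j) \<le> neumann_counting (ball (0 :: real ^ 2) 1) lam"
    by (meson enat_ord_simps(1) order_trans)
  then have "ereal_of_enat (enat (Suc j)) \<le> ereal_of_enat (neumann_counting (ball (0 :: real ^ 2) 1) lam)"
    by (simp only: ereal_of_enat_le_iff)
  moreover have "ereal (lam\<^sup>2 / 4) \<le> ereal_of_enat (enat (Suc j))" using j'(2) by simp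
  ultimately show ?thesis by (rule order_trans[rotated])
qed

end
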